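(* Let $F$ be the fork graph with vertex set $\{u,v,w,x,y\}$ and edge set $\{uv, vw, wx, wy\}$. For an integer $k\ge 1$, let $F^{(k)}_w$ be the graph obtained from $F$ by replacing the vertex $w$ by a complete graph $K_{k+1}$ on new vertices $w_0,\dots,w_k$, each of which is adjacent to $v$, $x$ and $y$ (and to each other). Then for any $k\geq 1$, \begin{align*} X_{F^{(k)}_w}=&\, (k + 1)! s_{(3,2,1^k)} + (k + 3) (k + 1)! s_{(3,1^{k+2})} -2(k + 1)! s_{(2^3,1^{k-1})} \\ &+ 5(k + 1)(k + 1)! s_{(2^2,1^{k+1})} + (k^{3} + 5 k^{2} + 14 k + 14) (k + 1)! s_{(2,1^{k+3})} \\ &+ 2 (k + 2)^{3} (k + 1)! s_{(1^{k+5})}. \end{align*} In particular, $X_{F^{(k)}_w}$ is not $s$-positive.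
   Context: For a finite simple graph $G$ with vertex set $\{v_1,\dots,v_d\}$, the chromatic symmetric function is $X_G=\sum_{\kappa} x_{\kappa(v_1)}\cdots x_{\kappa(v_d)}$, summed over all proper colorings $\kappa:V(G)\to\{1,2,\dots\}$, with commuting indeterminates. $s_\lambda$ denotes the Schur function indexed by the partition $\lambda$; $G$ is $s$-positive if all coefficients of $X_G$ in the Schur basis are non-negative. Partition notation: $(a^{m},b^{n},\dots)$ has $m$ parts equal to $a$, $n$ parts equal to $b$, etc.; e.g. $(2^3,1^{k-1})$ has three parts $2$ and $k-1$ parts $1$ (for $k=1$ this is $(2,2,2)$). *)

theory Defs
  imports Complex_Main "HOL-Library.Multiset" "HOL-Library.FuncSet"
begin

type_synonym 'a ugraph = "'a set \<times> 'a set set"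

definition verts :: "'a ugraph \<Rightarrow> 'a set" where
  "verts G = fst G"

definition edges :: "'a ugraph \<Rightarrow> 'a set set" where
  "edges G = snd G"

definition finite_simple_graph :: "'a ugraph \<Rightarrow> bool" where
  "finite_simple_graph G \<longleftrightarrow>
     finite (verts G) \<and>
     (\<forall>e\<in>edges G. \<exists>a\<in>verts G. \<exists>b\<in>verts G. a \<noteq> b \<and> e = {a, b})"

datatype fork_vertex = fork_u | fork_v | fork_w | fork_x | fork_y

definition fork_graph :: "fork_vertex ugraph" where
  "fork_graph =
     ({fork_u, fork_v, fork_w, fork_x, fork_y},
      {{fork_u, fork_v}, {fork_v, fork_w}, {fork_w, fork_x}, {fork_w, fork_y}})"

text \<open>
  Replacement of the vertex \<open>w\<close> by a complete graph on \<open>k + 1\<close> new vertices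
  \<open>Inr 0, \<dots>, Inr k\<close>; the old vertices \<open>a \<noteq> w\<close> are kept as \<open>Inl a\<close>.
\<close>

definition replace_by_clique :: "'a ugraph \<Rightarrow> 'a \<Rightarrow> nat \<Rightarrow> ('a + nat) ugraph" where
  "replace_by_clique G w k =
     (Inl ` (verts G - {w}) \<union> Inr ` {..k},
      {{Inl a, Inl b} | a b. {a, b} \<in> edges G \<and> a \<noteq> w \<and> b \<noteq> w}
      \<union> {{Inl a, Inr i} | a i. {a, w} \<in> edges G \<and> a \<noteq> w \<and> i \<le> k}
      \<union> {{Inr i, Inr j} | i j. i \<le> k \<and> j \<le> k \<and> i \<noteq> j})"

lemma finite_simple_graph_replace_by_clique:
  assumes "finite_simple_graph G"
  shows "finite_simple_graph (replace_by_clique G w k)"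
proof -
  have adj: "a \<in> verts G \<and> b \<in> verts G \<and> a \<noteq> b" if "{a, b} \<in> edges G" for a b
    using assms that unfolding finite_simple_graph_def
    by (metis doubleton_eq_iff)
  have fin: "finite (verts (replace_by_clique G w k))"
    using assms by (simp add: finite_simple_graph_def replace_by_clique_def verts_def)
  show ?thesis
    unfolding finite_simple_graph_def
  proof (intro conjI ballI fin)
    fix e assume "e \<in> edges (replace_by_clique G w k)"
    then consider
        (old) a b where "e = {Inl a, Inl b}" "{a, b} \<in> edges G" "a \<noteq> w" "b \<noteq> w"
      | (mixed) a i where "e = {Inl a, Inr i}" "{a, w} \<in> edges G" "a \<noteq> w" "i \<le> k"
      | (new) i j where "e = {Inr i, Inr j}" "i \<le> k" "j \<le> k" "i \<noteq> j"
      by (auto simp: replace_by_clique_def edges_def)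
    then show "\<exists>a\<in>verts (replace_by_clique G w k). \<exists>b\<in>verts (replace_by_clique G w k).
                 a \<noteq> b \<and> e = {a, b}"
    proof cases
      case old
      with adj[of a b] show ?thesis
        by (intro bexI[of _ "Inl a"] bexI[of _ "Inl b"])
          (auto simp: replace_by_clique_def verts_def)
    next
      case mixed
      with adj[of a w] show ?thesis
        by (intro bexI[of _ "Inl a"] bexI[of _ "Inr i"])
          (auto simp: replace_by_clique_def verts_def)
    next
      case new
      then show ?thesis
        by (intro bexI[of _ "Inr i"] bexI[of _ "Inr j"])
          (auto simp: replace_by_clique_def verts_def)
    qed
  qed
qed

lemma finite_simple_graph_fork: "finite_simple_graph fork_graph"
  by (auto simp: finite_simple_graph_def fork_graph_def verts_def edges_def)

text \<open>
  A formal power series in the commuting indeterminates \<open>x\<^sub>1, x\<^sub>2, \<dots>\<close> is given by its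
  coefficients; the multiset \<open>{#i\<^sub>1, \<dots>, i\<^sub>d#}\<close> stands for the monomial
  \<open>x\<^bsub>i\<^sub>1\<^esub> \<cdots> x\<^bsub>i\<^sub>d\<^esub>\<close>.
\<close>

type_synonym power_series = "nat multiset \<Rightarrow> rat"

text \<open>Colorings and tableaux are extensional functions, so that each is counted once.\<close>

definition proper_coloring :: "'a ugraph \<Rightarrow> ('a \<Rightarrow> nat) \<Rightarrow> bool" where
  "proper_coloring G \<kappa> \<longleftrightarrow>
     \<kappa> \<in> verts G \<rightarrow>\<^sub>E {1..} \<and> (\<forall>a b. {a, b} \<in> edges G \<longrightarrow> \<kappa> a \<noteq> \<kappa> b)"

definition chromatic_sym :: "'a ugraph \<Rightarrow> power_series" where
  "chromatic_sym G = (\<lambda>m.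
     of_nat (card {\<kappa>. proper_coloring G \<kappa> \<and> image_mset \<kappa> (mset_set (verts G)) = m}))"

definition is_partition :: "nat list \<Rightarrow> bool" where
  "is_partition \<mu> \<longleftrightarrow> sorted_wrt (\<ge>) \<mu> \<and> (\<forall>p\<in>set \<mu>. p \<ge> 1)"

definition young_diagram :: "nat list \<Rightarrow> (nat \<times> nat) set" where
  "young_diagram \<mu> = {(i, j). i < length \<mu> \<and> j < \<mu> ! i}"

definition semistandard_tableau :: "nat list \<Rightarrow> (nat \<times> nat \<Rightarrow> nat) \<Rightarrow> bool" where
  "semistandard_tableau \<mu> T \<longleftrightarrow>
     T \<in> young_diagram \<mu> \<rightarrow>\<^sub>E {1..} \<and>
     (\<forall>i j j'. (i, j) \<in> young_diagram \<mu> \<and> (i, j') \<in> young_diagram \<mu> \<and> j < j'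
        \<longrightarrow> T (i, j) \<le> T (i, j')) \<and>
     (\<forall>i i' j. (i, j) \<in> young_diagram \<mu> \<and> (i', j) \<in> young_diagram \<mu> \<and> i < i'
        \<longrightarrow> T (i, j) < T (i', j))"

definition schur :: "nat list \<Rightarrow> power_series" where
  "schur \<mu> = (\<lambda>m.
     of_nat (card {T. semistandard_tableau \<mu> T \<and> image_mset T (mset_set (young_diagram \<mu>)) = m}))"

definition schur_expansion :: "(nat list \<Rightarrow> rat) \<Rightarrow> power_series \<Rightarrow> bool" where
  "schur_expansion c f \<longleftrightarrow>
     finite {\<mu>. c \<mu> \<noteq> 0} \<and> (\<forall>\<mu>. c \<mu> \<noteq> 0 \<longrightarrow> is_partition \<mu>) \<and>
     f = (\<lambda>m. \<Sum>\<mu> | c \<mu> \<noteq> 0. c \<mu> * schur \<mu> m)"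

text \<open>
  The Schur functions being linearly independent, the coefficient family \<open>c\<close> below is the
  only one that can occur.
\<close>

definition schur_positive :: "power_series \<Rightarrow> bool" where
  "schur_positive f \<longleftrightarrow> (\<exists>c. schur_expansion c f \<and> (\<forall>\<mu>. c \<mu> \<ge> 0))"

end

theory Submission
  imports Defs
begin

text \<open>
  Both sides are compared coefficient by coefficient. For a content in which \<open>s\<close>, \<open>d\<close>, \<open>t\<close> values
  have multiplicity 1, 2, 3, deleting the largest value of a tableau (a horizontal strip) gives a
  recursion that determines the six Kostka numbers as polynomials in \<open>s\<close> for each \<open>d\<close>, \<open>t\<close>. A proper
  coloring with that content amounts to admissible colors of \<open>u, v, x, y\<close> and a bijection from the
  clique to the remaining colors, and their number is \<open>(k + 1)!\<close> times a polynomial in \<open>s\<close>.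

  The coefficient of \<open>X\<close> at content \<open>(3, 1, 2, 1, \<dots>, 1)\<close> is non-zero while the one at
  \<open>(2, 2, 2, 1, \<dots>, 1)\<close> vanishes. Since every shape that has a tableau of the first content also has
  one of the second, no expansion with non-negative coefficients exists; this avoids the linear
  independence of the Schur functions.
\<close>

section \<open>Semistandard tableaux on sets of cells\<close>

text \<open>Fillings of an arbitrary set of cells, so that deleting a strip stays inside the
  definition. Positivity of the entries enters through the content, by \<open>0 \<notin># m\<close>
  in \<open>schur_eq_card_ssyt\<close>.\<close>

definition ssyt :: "(nat \<times> nat) set \<Rightarrow> nat multiset \<Rightarrow> (nat \<times> nat \<Rightarrow> nat) set" where
  "ssyt D m = {T. T \<in> extensional D \<and>
     (\<forall>i j j'. (i, j) \<in> D \<and> (i, j') \<in> D \<and> j < j' \<longrightarrow> T (i, j) \<le> T (i, j')) \<and>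
     (\<forall>i i' j. (i, j) \<in> D \<and> (i', j) \<in> D \<and> i < i' \<longrightarrow> T (i, j) < T (i', j)) \<and>
     image_mset T (mset_set D) = m}"

lemma finite_young_diagram: "finite (young_diagram \<mu>)"
proof -
  have "young_diagram \<mu> = Sigma {..<length \<mu>} (\<lambda>i. {..<\<mu> ! i})"
    by (auto simp: young_diagram_def)
  then show ?thesis by simp
qed

lemma ssyt_value_mem:
  assumes "finite D" "T \<in> ssyt D m" "z \<in> D"
  shows "T z \<in># m"
  using assms by (auto simp: ssyt_def)

lemma finite_ssyt:
  assumes "finite D"
  shows "finite (ssyt D m)"
proof (rule finite_subset)
  show "ssyt D m \<subseteq> D \<rightarrow>\<^sub>E set_mset m"
    proof
    fix T assume T: "T \<in> ssyt D m"
    then have "T \<in> extensional D" by (simp add: ssyt_def)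
    then show "T \<in> D \<rightarrow>\<^sub>E set_mset m"
      using ssyt_value_mem[OF assms T] by (auto simp: PiE_def)
  qed
  show "finite (D \<rightarrow>\<^sub>E set_mset m)"
    using assms by (intro finite_PiE) auto
qed

lemma schur_eq_card_ssyt:
  assumes "0 \<notin># m"
  shows "schur \<mu> m = of_nat (card (ssyt (young_diagram \<mu>) m))"
proof -
  have "{T. semistandard_tableau \<mu> T \<and> image_mset T (mset_set (young_diagram \<mu>)) = m}
      = ssyt (young_diagram \<mu>) m" (is "?L = ?R")
  proof
    show "?L \<subseteq> ?R"
      by (auto simp: semistandard_tableau_def ssyt_def PiE_def)
    show "?R \<subseteq> ?L"
    proof
      fix T assume T: "T \<in> ?R"
      have "T z \<ge> 1" if "z \<in> young_diagram \<mu>" for z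
        using ssyt_value_mem[OF finite_young_diagram T that] assms by (cases "T z") auto
      with T show "T \<in> ?L"
        by (auto simp: semistandard_tableau_def ssyt_def PiE_def)
    qed
  qed
  then show ?thesis by (simp add: schur_def)
qed

text \<open>The cells that can be occupied by the largest value of a tableau.\<close>

definition top_strips :: "(nat \<times> nat) set \<Rightarrow> nat \<Rightarrow> (nat \<times> nat) set set" where
  "top_strips D c = {S. S \<subseteq> D \<and> card S = c \<and>
     (\<forall>i j j'. (i, j) \<in> S \<and> (i, j') \<in> D \<and> j < j' \<longrightarrow> (i, j') \<in> S) \<and>
     (\<forall>i i' j. (i, j) \<in> S \<and> (i', j) \<in> D \<longrightarrow> i' \<le> i)}"

lemma top_stripsD:
  assumes "S \<in> top_strips D c"
  shows "S \<subseteq> D" "card S = c"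
    and "\<And>i j j'. (i, j) \<in> S \<Longrightarrow> (i, j') \<in> D \<Longrightarrow> j < j' \<Longrightarrow> (i, j') \<in> S"
    and "\<And>i i' j. (i, j) \<in> S \<Longrightarrow> (i', j) \<in> D \<Longrightarrow> i' \<le> i"
  using assms unfolding top_strips_def by blast+

lemma image_mset_split:
  assumes "finite D" "S \<subseteq> D"
  shows "image_mset T (mset_set D) = image_mset T (mset_set (D - S)) + image_mset T (mset_set S)"
proof -
  have "mset_set D = mset_set (D - S) + mset_set S"
    using assms mset_set_Union[of "D - S" S] finite_subset[OF assms(2,1)]
    by (simp add: Un_absorb2 Int_commute)
  then show ?thesis by simp
qed

lemma image_mset_const_on:
  assumes "\<And>z. z \<in> S \<Longrightarrow> T z = M"
  shows "image_mset T (mset_set S) = replicate_mset (card S) M"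
proof (cases "finite S")
  case True
  then have "image_mset T (mset_set S) = image_mset (\<lambda>_. M) (mset_set S)"
    using assms by (intro image_mset_cong) auto
  then show ?thesis by (simp add: image_mset_const_eq)
qed simp

text \<open>The cells that hold the maximum \<open>M\<close> form a strip with at most one cell per
  column, closed to the right in rows. Erasing them leaves a tableau of content \<open>m\<close>;
  since \<open>M\<close> exceeds every value of \<open>m\<close>, filling any such strip with
  \<open>M\<close> undoes this.\<close>

lemma card_ssyt_remove_max:
  assumes D: "finite D" and M: "\<And>v. v \<in># m \<Longrightarrow> v < M"
  shows "card (ssyt D (m + replicate_mset c M)) = (\<Sum>S\<in>top_strips D c. card (ssyt (D - S) m))"
proof -
  let ?m = "m + replicate_mset c M"
  let ?S = "\<lambda>T. {z \<in> D. T z = M}"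
  let ?f = "\<lambda>T. (?S T, restrict T (D - ?S T))"
  let ?g = "\<lambda>(S, T') z. if z \<in> S then M else T' z"
  have fwd: "?f T \<in> (SIGMA S:top_strips D c. ssyt (D - S) m)" and gf: "?g (?f T) = T"
    if T: "T \<in> ssyt D ?m" for T
  proof -
    have le: "T z \<le> M" if "z \<in> D" for z
      using ssyt_value_mem[OF D T that] M by (auto intro: less_imp_le split: if_splits)
    have eq: "image_mset T (mset_set (D - ?S T)) + replicate_mset (card (?S T)) M = ?m"
      using T image_mset_split[OF D, of "?S T" T] image_mset_const_on[of "?S T" T M]
      by (auto simp: ssyt_def)
    \<comment> \<open>\<open>M\<close> occurs neither in \<open>m\<close> nor in the cells of
      \<open>D\<close> outside \<open>?S T\<close>, so its multiplicity on both sides of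
      \<open>eq\<close> gives the size of the strip.\<close>
    have "count (image_mset T (mset_set (D - ?S T))) M = 0" "count m M = 0"
      using D M by (auto simp: count_eq_zero_iff)
    then have card: "card (?S T) = c"
      using arg_cong[OF eq, of "\<lambda>m. count m M"] by simp
    have "image_mset (restrict T (D - ?S T)) (mset_set (D - ?S T))
        = image_mset T (mset_set (D - ?S T))"
      using D by (intro image_mset_cong) auto
    with eq card have m: "image_mset (restrict T (D - ?S T)) (mset_set (D - ?S T)) = m"
      by simp
    have row: "T (i, j) \<le> T (i, j')" if "(i, j) \<in> D" "(i, j') \<in> D" "j < j'" for i j j'
      using T that by (auto simp: ssyt_def)
    have col: "T (i, j) < T (i', j)" if "(i, j) \<in> D" "(i', j) \<in> D" "i < i'" for i i' j
      using T that by (auto simp: ssyt_def)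
    have "?S T \<in> top_strips D c"
      unfolding top_strips_def
    proof (rule CollectI, intro conjI allI impI card)
      fix i j j' assume "(i, j) \<in> ?S T \<and> (i, j') \<in> D \<and> j < j'"
      then show "(i, j') \<in> ?S T" using row[of i j j'] le[of "(i, j')"] by auto
    next
      fix i i' j assume "(i, j) \<in> ?S T \<and> (i', j) \<in> D"
      then show "i' \<le> i" using col[of i j i'] le[of "(i', j)"] by (auto intro: leI)
    qed auto
    moreover have "restrict T (D - ?S T) \<in> ssyt (D - ?S T) m"
      using m row col by (auto simp: ssyt_def)
    ultimately show "?f T \<in> (SIGMA S:top_strips D c. ssyt (D - S) m)" by auto
    show "?g (?f T) = T"
      using T by (auto simp: ssyt_def fun_eq_iff extensional_def)
  qed
  have bwd: "?g p \<in> ssyt D ?m" and fg: "?f (?g p) = p"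
    if p: "p \<in> (SIGMA S:top_strips D c. ssyt (D - S) m)" for p
  proof -
    obtain S T' where p': "p = (S, T')" and S: "S \<in> top_strips D c" and T': "T' \<in> ssyt (D - S) m"
      using p by auto
    note SD = top_stripsD(1)[OF S] and card = top_stripsD(2)[OF S]
      and row = top_stripsD(3)[OF S] and col = top_stripsD(4)[OF S]
    have lt: "T' z < M" if "z \<in> D" "z \<notin> S" for z
      using ssyt_value_mem[OF _ T', of z] D that M by auto
    have SS: "?S (?g p) = S"
      using SD lt by (auto simp: p')
    have "image_mset (?g p) (mset_set (D - S)) = image_mset T' (mset_set (D - S))"
      using D by (intro image_mset_cong) (auto simp: p')
    also have "\<dots> = m" using T' by (simp add: ssyt_def)
    finally have "image_mset (?g p) (mset_set D) = ?m"
      using image_mset_split[OF D SD, of "?g p"] image_mset_const_on[of S "?g p" M] card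
      by (simp add: p')
    moreover have "?g p \<in> extensional D"
      using T' SD by (auto simp: p' ssyt_def extensional_def)
    moreover have "?g p (i, j) \<le> ?g p (i, j')" if "(i, j) \<in> D" "(i, j') \<in> D" "j < j'" for i j j'
      using T' that row[of i j j'] lt[of "(i, j)"] by (auto simp: p' ssyt_def)
    moreover have "?g p (i, j) < ?g p (i', j)" if "(i, j) \<in> D" "(i', j) \<in> D" "i < i'" for i i' j
      using T' that col[of i j i'] lt[of "(i, j)"] by (auto simp: p' ssyt_def)
    ultimately show "?g p \<in> ssyt D ?m"
      unfolding ssyt_def by blast
    have "restrict (?g p) (D - S) = T'"
      using T' by (auto simp: p' ssyt_def fun_eq_iff extensional_def)
    then show "?f (?g p) = p"
      unfolding SS by (simp add: p')
  qed
  have "bij_betw ?f (ssyt D ?m) (SIGMA S:top_strips D c. ssyt (D - S) m)"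
  proof (rule bij_betw_byWitness[where f' = ?g])
    show "\<forall>T\<in>ssyt D ?m. ?g (?f T) = T" using gf by (intro ballI)
    show "\<forall>p\<in>SIGMA S:top_strips D c. ssyt (D - S) m. ?f (?g p) = p" using fg by (intro ballI)
    show "?f ` ssyt D ?m \<subseteq> (SIGMA S:top_strips D c. ssyt (D - S) m)" using fwd by (intro image_subsetI)
    show "?g ` (SIGMA S:top_strips D c. ssyt (D - S) m) \<subseteq> ssyt D ?m" using bwd by (intro image_subsetI)
  qed
  then have "card (ssyt D ?m) = card (SIGMA S:top_strips D c. ssyt (D - S) m)"
    by (rule bij_betw_same_card)
  also have "\<dots> = (\<Sum>S\<in>top_strips D c. card (ssyt (D - S) m))"
    using D by (intro card_SigmaI) (auto intro!: finite_ssyt finite_subset[of "top_strips D c" "Pow D"] simp: top_strips_def)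
  finally show ?thesis .
qed

section \<open>Shapes with three columns and their horizontal strips\<close>

text \<open>All shapes of the theorem have at most three columns. Column lengths suit the recursion,
  because a horizontal strip shortens each column by at most one.\<close>

definition columns3 :: "nat \<Rightarrow> nat \<Rightarrow> nat \<Rightarrow> (nat \<times> nat) set" where
  "columns3 a b c = {..<a} \<times> {0} \<union> {..<b} \<times> {1} \<union> {..<c} \<times> {2}"

lemma mem_columns3:
  "(i, j) \<in> columns3 a b c \<longleftrightarrow> j = 0 \<and> i < a \<or> j = 1 \<and> i < b \<or> j = 2 \<and> i < c"
  by (auto simp: columns3_def)

lemma finite_columns3: "finite (columns3 a b c)"
  by (simp add: columns3_def)

lemma card_columns3: "card (columns3 a b c) = a + b + c"
  unfolding columns3_def
  by (subst card_Un_disjoint; auto simp: card_cartesian_product)+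

text \<open>A strip of \<open>x\<close> cells is encoded by the column lengths it leaves; closure to
  the right in rows becomes the condition that these lengths still decrease weakly.\<close>

definition strip_removals3 :: "nat \<Rightarrow> nat \<Rightarrow> nat \<Rightarrow> nat \<Rightarrow> (nat \<times> nat \<times> nat) set" where
  "strip_removals3 a b c x = {(a', b', c'). a' \<le> a \<and> a \<le> a' + 1 \<and> b' \<le> b \<and> b \<le> b' + 1 \<and>
     c' \<le> c \<and> c \<le> c' + 1 \<and> b' \<le> a' \<and> c' \<le> b' \<and> a' + b' + c' + x = a + b + c}"

lemma columns3_subset:
  "a' \<le> a \<Longrightarrow> b' \<le> b \<Longrightarrow> c' \<le> c \<Longrightarrow> columns3 a' b' c' \<subseteq> columns3 a b c"
  by (auto simp: columns3_def)

lemma columns3_inject: "columns3 a b c = columns3 a' b' c' \<longleftrightarrow> a = a' \<and> b = b' \<and> c = c'"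
proof
  assume eq: "columns3 a b c = columns3 a' b' c'"
  have "i < a \<longleftrightarrow> i < a'" "i < b \<longleftrightarrow> i < b'" "i < c \<longleftrightarrow> i < c'" for i
    using mem_columns3[of i 0 a b c] mem_columns3[of i 0 a' b' c'] mem_columns3[of i 1 a b c]
      mem_columns3[of i 1 a' b' c'] mem_columns3[of i 2 a b c] mem_columns3[of i 2 a' b' c']
    by (simp_all add: eq)
  then show "a = a' \<and> b = b' \<and> c = c'"
    by (metis nat_neq_iff)
qed simp

lemma card_columns3_diff:
  assumes "a' \<le> a" "b' \<le> b" "c' \<le> c"
  shows "card (columns3 a b c - columns3 a' b' c') + (a' + b' + c') = a + b + c"
proof -
  have "card (columns3 a b c - columns3 a' b' c') = (a + b + c) - (a' + b' + c')"
    using columns3_subset[OF assms] by (simp add: card_Diff_subset finite_columns3 card_columns3)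
  then show ?thesis using assms by simp
qed

text \<open>A strip can contain only the bottom cell of each column, so it is determined by the
  lengths that remain.\<close>

lemma bij_betw_strip_removals3:
  assumes ab: "b \<le> a" and bc: "c \<le> b"
  shows "bij_betw (\<lambda>(a', b', c'). columns3 a b c - columns3 a' b' c')
           (strip_removals3 a b c x) (top_strips (columns3 a b c) x)"
  unfolding bij_betw_def
proof
  let ?D = "columns3 a b c"
  have sub: "columns3 a' b' c' \<subseteq> ?D" if "(a', b', c') \<in> strip_removals3 a b c x" for a' b' c'
    using that by (intro columns3_subset) (auto simp: strip_removals3_def)
  show "inj_on (\<lambda>(a', b', c'). ?D - columns3 a' b' c') (strip_removals3 a b c x)"
  proof (rule inj_onI, clarsimp)
    fix a1 b1 c1 a2 b2 c2
    assume 1: "(a1, b1, c1) \<in> strip_removals3 a b c x" and 2: "(a2, b2, c2) \<in> strip_removals3 a b c x"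
      and eq: "?D - columns3 a1 b1 c1 = ?D - columns3 a2 b2 c2"
    from eq sub[OF 1] sub[OF 2] have "columns3 a1 b1 c1 = columns3 a2 b2 c2" by blast
    then show "a1 = a2 \<and> b1 = b2 \<and> c1 = c2" by (simp add: columns3_inject)
  qed
  show "(\<lambda>(a', b', c'). ?D - columns3 a' b' c') ` strip_removals3 a b c x = top_strips ?D x"
  proof
    show "(\<lambda>(a', b', c'). ?D - columns3 a' b' c') ` strip_removals3 a b c x \<subseteq> top_strips ?D x"
    proof clarify
      fix a' b' c' assume *: "(a', b', c') \<in> strip_removals3 a b c x"
      then have "card (?D - columns3 a' b' c') = x"
        using card_columns3_diff[of a' a b' b c' c] by (simp add: strip_removals3_def)
      with * show "?D - columns3 a' b' c' \<in> top_strips ?D x"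
        by (auto simp: top_strips_def mem_columns3 strip_removals3_def)
    qed
    show "top_strips ?D x \<subseteq> (\<lambda>(a', b', c'). ?D - columns3 a' b' c') ` strip_removals3 a b c x"
    proof
      fix S assume S: "S \<in> top_strips ?D x"
      \<comment> \<open>\<open>h l j\<close> is the length that column \<open>j\<close>, originally
        of length \<open>l\<close>, keeps once the strip is removed.\<close>
      define h where "h l j = (if (l - 1, j) \<in> S \<and> 0 < l then l - 1 else l)" for l j :: nat
      note SD = top_stripsD(1)[OF S] and card = top_stripsD(2)[OF S]
        and row = top_stripsD(3)[OF S] and col = top_stripsD(4)[OF S]
      have bot: "i = a - 1 \<and> 0 < a" if "(i, 0) \<in> S" for i
        using col[OF that, of "a - 1"] subsetD[OF SD that] by (auto simp: mem_columns3)
      have bot1: "i = b - 1 \<and> 0 < b" if "(i, 1) \<in> S" for i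
        using col[OF that, of "b - 1"] subsetD[OF SD that] by (auto simp: mem_columns3)
      have bot2: "i = c - 1 \<and> 0 < c" if "(i, 2) \<in> S" for i
        using col[OF that, of "c - 1"] subsetD[OF SD that] by (auto simp: mem_columns3)
      have h: "(i, j) \<in> S \<longleftrightarrow> i < l \<and> \<not> i < h l j"
        if "\<forall>i. (i, j) \<in> S \<longrightarrow> i = l - 1 \<and> 0 < l" for i j l
      proof (cases "i = l - 1")
        case True
        then show ?thesis using that by (auto simp: h_def)
      next
        case False
        then have "(i, j) \<notin> S" using that by auto
        with False show ?thesis by (auto simp: h_def)
      qed
      have S': "S = ?D - columns3 (h a 0) (h b 1) (h c 2)" (is "S = ?R")
      proof (rule set_eqI, simp only: split_paired_all)
        fix i j :: nat
        consider "j = 0" | "j = 1" | "j = 2" | "j > 2" by linarith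
        then show "(i, j) \<in> S \<longleftrightarrow> (i, j) \<in> ?R"
        proof cases
          case 1
          then show ?thesis using h[where i = i and j = 0 and l = a] bot by (simp add: mem_columns3)
        next
          case 2
          then show ?thesis using h[where i = i and j = 1 and l = b] bot1 by (simp add: mem_columns3)
        next
          case 3
          then show ?thesis using h[where i = i and j = 2 and l = c] bot2 by (simp add: mem_columns3)
        next
          case 4
          then show ?thesis using SD by (auto simp: mem_columns3)
        qed
      qed
      have le: "h a 0 \<le> a" "h b 1 \<le> b" "h c 2 \<le> c" by (auto simp: h_def)
      \<comment> \<open>Only equally long columns are delicate: if the left one loses its bottom
        cell, the row condition puts the cell to its right into the strip as well.\<close>
      have "h b 1 \<le> h a 0"
        using row[of "a - 1" 0 1] ab by (cases "a = b") (auto simp: h_def mem_columns3)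
      moreover have "h c 2 \<le> h b 1"
        using row[of "b - 1" 1 2] bc by (cases "b = c") (auto simp: h_def mem_columns3)
      ultimately have "(h a 0, h b 1, h c 2) \<in> strip_removals3 a b c x"
        using card_columns3_diff[OF le, folded S'] card le by (simp add: strip_removals3_def) (simp add: h_def)
      then show "S \<in> (\<lambda>(a', b', c'). ?D - columns3 a' b' c') ` strip_removals3 a b c x"
        by (intro image_eqI[of _ _ "(h a 0, h b 1, h c 2)"]) (use S' in simp_all)
    qed
  qed
qed

lemma card_ssyt_columns3_remove_max:
  assumes ab: "b \<le> a" and bc: "c \<le> b" and M: "\<And>v. v \<in># m \<Longrightarrow> v < M"
  shows "card (ssyt (columns3 a b c) (m + replicate_mset x M))
       = (\<Sum>(a', b', c')\<in>strip_removals3 a b c x. card (ssyt (columns3 a' b' c') m))"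
proof -
  let ?D = "columns3 a b c"
  have "card (ssyt ?D (m + replicate_mset x M)) = (\<Sum>S\<in>top_strips ?D x. card (ssyt (?D - S) m))"
    by (rule card_ssyt_remove_max[OF finite_columns3 M])
  also have "\<dots> = (\<Sum>(a', b', c')\<in>strip_removals3 a b c x.
      card (ssyt (?D - (?D - columns3 a' b' c')) m))"
    by (subst sum.reindex_bij_betw[OF bij_betw_strip_removals3[OF ab bc], symmetric])
      (simp add: case_prod_beta)
  also have "\<dots> = (\<Sum>(a', b', c')\<in>strip_removals3 a b c x. card (ssyt (columns3 a' b' c') m))"
  proof (rule sum.cong[OF refl], clarify)
    fix a' b' c' assume "(a', b', c') \<in> strip_removals3 a b c x"
    then have "columns3 a' b' c' \<subseteq> ?D"
      by (intro columns3_subset) (auto simp: strip_removals3_def)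
    then show "card (ssyt (?D - (?D - columns3 a' b' c')) m) = card (ssyt (columns3 a' b' c') m)"
      by (simp add: double_diff)
  qed
  finally show ?thesis .
qed

section \<open>Kostka numbers of shapes with three columns\<close>

text \<open>All copies of the largest element go at once, which is what the deletion of one strip
  does to the content.\<close>

lemma multiset_induct_remove_max [case_names empty add]:
  fixes m :: "'a :: linorder multiset"
  assumes "P {#}"
    and "\<And>m M x. (\<And>v. v \<in># m \<Longrightarrow> v < M) \<Longrightarrow> 0 < x \<Longrightarrow> P m \<Longrightarrow> P (m + replicate_mset x M)"
  shows "P m"
proof (induction "size m" arbitrary: m rule: less_induct)
  case less
  show ?case
  proof (cases "m = {#}")
    case False
    define M where "M = Max (set_mset m)"
    have M: "M \<in># m" "\<And>v. v \<in># m \<Longrightarrow> v \<le> M"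
      using False by (auto simp: M_def)
    have eq: "m = filter_mset (\<lambda>v. v \<noteq> M) m + replicate_mset (count m M) M"
      by (rule multiset_eqI) auto
    have "P (filter_mset (\<lambda>v. v \<noteq> M) m)"
    proof (rule less)
      have "size m = size (filter_mset (\<lambda>v. v \<noteq> M) m) + count m M"
        using arg_cong[OF eq, of size] by simp
      then show "size (filter_mset (\<lambda>v. v \<noteq> M) m) < size m"
        using M(1) by (simp add: count_greater_zero_iff[symmetric] del: count_greater_zero_iff)
    qed
    then show ?thesis
      by (subst eq) (intro assms(2), use M in \<open>auto simp: order_le_neq_trans\<close>)
  qed (simp add: assms(1))
qed

definition values_of_mult :: "nat \<Rightarrow> 'a multiset \<Rightarrow> 'a set" where
  "values_of_mult i m = {v. count m v = i}"

lemma finite_values_of_mult: "0 < i \<Longrightarrow> finite (values_of_mult i m)"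
  by (rule finite_subset[of _ "set_mset m"]) (auto simp: values_of_mult_def intro: count_inI)

lemma card_values_of_mult_add:
  assumes "M \<notin># m" "0 < x" "0 < i"
  shows "card (values_of_mult i (m + replicate_mset x M))
       = card (values_of_mult i m) + (if i = x then 1 else 0)"
proof -
  have "values_of_mult i (m + replicate_mset x M) = values_of_mult i m \<union> (if i = x then {M} else {})"
    using assms by (auto simp: values_of_mult_def not_in_iff split: if_splits)
  then show ?thesis
    using assms finite_values_of_mult[OF assms(3), of m]
    by (auto simp: values_of_mult_def not_in_iff)
qed

lemma all_count_le_add_iff:
  assumes "M \<notin># m"
  shows "(\<forall>v. count (m + replicate_mset x M) v \<le> n) \<longleftrightarrow> x \<le> n \<and> (\<forall>v. count m v \<le> n)"
proof
  assume "\<forall>v. count (m + replicate_mset x M) v \<le> n"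
  then have *: "count m v + (if v = M then x else 0) \<le> n" for v
    by (auto split: if_splits)
  show "x \<le> n \<and> (\<forall>v. count m v \<le> n)"
    using *[of M] * by (metis add_leE)
qed (use assms in \<open>auto simp: not_in_iff\<close>)

lemma size_eq_sum_mult:
  fixes m :: "'a :: linorder multiset"
  assumes "\<forall>v. count m v \<le> 3"
  shows "size m = card (values_of_mult 1 m) + 2 * card (values_of_mult 2 m)
    + 3 * card (values_of_mult 3 m)"
  using assms
proof (induction m rule: multiset_induct_remove_max)
  case empty
  then show ?case by (simp add: values_of_mult_def)
next
  case (add m M x)
  have M: "M \<notin># m" using add.hyps(1)[of M] by auto
  then have "x \<le> 3" "\<forall>v. count m v \<le> 3"
    using add.prems by (simp_all add: all_count_le_add_iff del: count_union)
  then consider "x = 1" | "x = 2" | "x = 3" using add.hyps(2) by linarith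
  then show ?case
    by (simp only: size_union size_replicate_mset card_values_of_mult_add[OF M add.hyps(2)]
        zero_less_numeral zero_less_one)
      (use add.IH \<open>\<forall>v. count m v \<le> 3\<close> in auto)
qed

text \<open>
  The Kostka number of the shape with column lengths \<open>n - b - c\<close>, \<open>b\<close>, \<open>c\<close> at a content in which
  \<open>s\<close>, \<open>d\<close> and \<open>t\<close> values have multiplicity 1, 2 and 3. By the dual Jacobi--Trudi formula it is an
  alternating sum of coefficients of \<open>(1 + y + z)\<^sup>s (y + z + y z)\<^sup>d (y z)\<^sup>t\<close>.
\<close>

definition col_kostka :: "nat \<Rightarrow> nat \<Rightarrow> nat \<Rightarrow> nat \<Rightarrow> nat \<Rightarrow> rat" where
  "col_kostka b c s d t = (let s = of_nat s in
     if (b, c) = (0, 0) then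
       (if (d, t) = (0, 0) then 1 else 0)
     else if (b, c) = (1, 0) then
       (if (d, t) = (0, 0) then s - 1 else if (d, t) = (1, 0) then 1 else 0)
     else if (b, c) = (2, 0) then
       (if (d, t) = (0, 0) then s * (s - 3) / 2 else if (d, t) = (1, 0) then s - 1
        else if (d, t) = (2, 0) then 1 else 0)
     else if (b, c) = (3, 0) then
       (if (d, t) = (0, 0) then s * (s - 1) * (s - 5) / 6
        else if (d, t) = (1, 0) then s * (s - 3) / 2
        else if (d, t) = (2, 0) then s - 1 else if (d, t) = (3, 0) then 1 else 0)
     else if (b, c) = (1, 1) then
       (if (d, t) = (0, 0) then (s - 1) * (s - 2) / 2 else if (d, t) = (1, 0) then s
        else if (d, t) = (2, 0) \<or> (d, t) = (0, 1) then 1 else 0)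
     else if (b, c) = (2, 1) then
       (if (d, t) = (0, 0) then s * (s - 2) * (s - 4) / 3 else if (d, t) = (1, 0) then s * (s - 2)
        else if (d, t) = (2, 0) then 2 * s else if (d, t) = (3, 0) then 2
        else if (d, t) = (0, 1) then s - 1 else if (d, t) = (1, 1) then 1 else 0)
     else 0)"

lemma nat_cases_upto_3:
  fixes n :: nat
  obtains "n = 0" | "n = 1" | "n = 2" | "n = 3" | "n \<ge> 4"
  by linarith

text \<open>The strip recursion for a largest value of multiplicity one: each summand shortens one
  column, and the first summand shortens the first column, whose length is implicit in the size of
  the content. As \<open>col_kostka\<close> vanishes for \<open>d\<close> or \<open>t\<close> from 4
  on, finitely many polynomial identities in \<open>s\<close> remain.\<close>

lemma col_kostka_add_single:
  "col_kostka 0 0 (Suc s) d t = col_kostka 0 0 s d t"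
  "col_kostka (Suc 0) 0 (Suc s) d t = col_kostka (Suc 0) 0 s d t + col_kostka 0 0 s d t"
  "col_kostka 2 0 (Suc s) d t = col_kostka 2 0 s d t + col_kostka (Suc 0) 0 s d t"
  "col_kostka 3 0 (Suc s) d t = col_kostka 3 0 s d t + col_kostka 2 0 s d t"
  "col_kostka (Suc 0) (Suc 0) (Suc s) d t = col_kostka (Suc 0) (Suc 0) s d t + col_kostka (Suc 0) 0 s d t"
  "col_kostka 2 (Suc 0) (Suc s) d t
     = col_kostka 2 (Suc 0) s d t + col_kostka (Suc 0) (Suc 0) s d t + col_kostka 2 0 s d t"
  by (cases d rule: nat_cases_upto_3; cases t rule: nat_cases_upto_3;
    simp add: col_kostka_def Let_def; simp add: field_simps)+

text \<open>Multiplicity two: two columns lose a cell each, and pairs that break the order of the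
  lengths contribute nothing. A single column cannot hold a value twice, hence the 0.\<close>

lemma col_kostka_add_double:
  "col_kostka 0 0 s (Suc d) t = 0"
  "col_kostka (Suc 0) 0 s (Suc d) t = col_kostka 0 0 s d t"
  "col_kostka 2 0 s (Suc d) t = col_kostka (Suc 0) 0 s d t"
  "col_kostka 3 0 s (Suc d) t = col_kostka 2 0 s d t"
  "col_kostka (Suc 0) (Suc 0) s (Suc d) t = col_kostka (Suc 0) 0 s d t + col_kostka 0 0 s d t"
  "col_kostka 2 (Suc 0) s (Suc d) t
     = col_kostka (Suc 0) (Suc 0) s d t + col_kostka 2 0 s d t + col_kostka (Suc 0) 0 s d t"
  by (cases d rule: nat_cases_upto_3; cases t rule: nat_cases_upto_3;
    simp add: col_kostka_def Let_def; simp add: field_simps)+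

text \<open>Multiplicity three: all three columns lose a cell, hence the 0 when the third is
  empty.\<close>

lemma col_kostka_add_triple:
  "col_kostka b 0 s d (Suc t) = 0"
  "col_kostka (Suc 0) (Suc 0) s d (Suc t) = col_kostka 0 0 s d t"
  "col_kostka 2 (Suc 0) s d (Suc t) = col_kostka (Suc 0) 0 s d t"
  by (cases d rule: nat_cases_upto_3; cases t rule: nat_cases_upto_3;
    simp add: col_kostka_def Let_def; simp add: field_simps)+

text \<open>Lengths of the second and third columns of the six shapes in the theorem. Strip removal
  does not lead out of this set, so the recursion closes.\<close>

definition col_shapes :: "(nat \<times> nat) set" where
  "col_shapes = {(0, 0), (1, 0), (2, 0), (3, 0), (1, 1), (2, 1)}"

text \<open>
  Column lengths \<open>b - 1\<close>, \<open>b\<close>, \<open>c\<close> make two rows of the Jacobi--Trudi determinant equal.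
\<close>

lemma col_kostka_degenerate:
  assumes "(b, c) \<in> col_shapes" "s + 2 * d + 3 * t + 1 = 2 * b + c"
  shows "col_kostka b c s d t = 0"
proof -
  have "t \<le> 1" "d \<le> 2" "s \<le> 5"
    using assms by (auto simp: col_shapes_def)
  then have "t \<in> {0, 1}" "d \<in> {0, 1, 2}" by auto
  with assms show ?thesis
    by (auto simp: col_shapes_def col_kostka_def)
qed

text \<open>The value 0 is correct beyond multiplicity three: equal entries lie in distinct columns,
  and there are only three.\<close>

definition content_kostka :: "nat \<Rightarrow> nat \<Rightarrow> nat multiset \<Rightarrow> rat" where
  "content_kostka b c m = (if \<forall>v. count m v \<le> 3 then
     col_kostka b c (card (values_of_mult 1 m)) (card (values_of_mult 2 m)) (card (values_of_mult 3 m))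
   else 0)"

text \<open>The default 0 covers \<open>b = a + 1\<close>, which is not a shape but arises formally
  when the first column is shortened; \<open>col_kostka_degenerate\<close> gives the same value
  there.\<close>

definition ssyt_columns_count :: "nat \<Rightarrow> nat \<Rightarrow> nat \<Rightarrow> nat multiset \<Rightarrow> rat" where
  "ssyt_columns_count a b c m = (if b \<le> a then of_nat (card (ssyt (columns3 a b c) m)) else 0)"

text \<open>The strip recursion as a sum over a box, ready to be unfolded term by term. The order of
  the first two columns is absorbed by the default value of \<open>ssyt_columns_count\<close>. For
  an empty column the index set \<open>{b - 1, b}\<close> or \<open>{c - 1, c}\<close> collapses to
  one element, so nothing is counted twice.\<close>

lemma ssyt_columns_count_remove_max:
  assumes "b \<le> Suc a" and "c \<le> b" and M: "\<And>v. v \<in># m \<Longrightarrow> v < M"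
  shows "ssyt_columns_count (Suc a) b c (m + replicate_mset x M)
       = (\<Sum>a'\<in>{a, Suc a}. \<Sum>b'\<in>{b - 1, b}. \<Sum>c'\<in>{c - 1, c}.
            if c' \<le> b' \<and> a' + b' + c' + x = Suc a + b + c then ssyt_columns_count a' b' c' m else 0)"
proof -
  let ?B = "{a, Suc a} \<times> {b - 1, b} \<times> {c - 1, c}"
  let ?P = "\<lambda>(a', b', c'). b' \<le> a' \<and> c' \<le> b' \<and> a' + b' + c' + x = Suc a + b + c"
  have sr: "strip_removals3 (Suc a) b c x = {p \<in> ?B. ?P p}"
  proof (rule set_eqI, simp only: split_paired_all)
    fix a' b' c' :: nat
    have "a' \<le> Suc a \<and> Suc a \<le> a' + 1 \<longleftrightarrow> a' \<in> {a, Suc a}"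
      "b' \<le> b \<and> b \<le> b' + 1 \<longleftrightarrow> b' \<in> {b - 1, b}" "c' \<le> c \<and> c \<le> c' + 1 \<longleftrightarrow> c' \<in> {c - 1, c}"
      by auto
    then show "(a', b', c') \<in> strip_removals3 (Suc a) b c x \<longleftrightarrow> (a', b', c') \<in> {p \<in> ?B. ?P p}"
      unfolding strip_removals3_def mem_Collect_eq case_prod_conv mem_Times_iff fst_conv snd_conv
      by blast
  qed
  have "ssyt_columns_count (Suc a) b c (m + replicate_mset x M)
      = (\<Sum>(a', b', c')\<in>strip_removals3 (Suc a) b c x. of_nat (card (ssyt (columns3 a' b' c') m)))"
    using card_ssyt_columns3_remove_max[OF assms]
    by (simp add: ssyt_columns_count_def assms(1) case_prod_beta)
  also have "\<dots> = (\<Sum>p\<in>?B. if ?P p then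
      (\<lambda>(a', b', c'). of_nat (card (ssyt (columns3 a' b' c') m))) p else 0)"
    unfolding sr by (rule sum.inter_filter) simp
  also have "\<dots> = (\<Sum>(a', b', c')\<in>?B.
      if c' \<le> b' \<and> a' + b' + c' + x = Suc a + b + c then ssyt_columns_count a' b' c' m else 0)"
    by (rule sum.cong[OF refl]) (simp add: ssyt_columns_count_def split: prod.splits)
  finally show ?thesis
    by (simp only: sum.cartesian_product)
qed

text \<open>Both sides obey the same recursion under removal of the largest value. The bound
  \<open>b \<le> a + 1\<close> instead of \<open>b \<le> a\<close> lets the induction hypothesis
  apply after the first column alone is shortened.\<close>

lemma ssyt_columns_count_eq:
  assumes "(b, c) \<in> col_shapes" "size m = a + b + c" "b \<le> a + 1"
  shows "ssyt_columns_count a b c m = content_kostka b c m"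
  using assms
proof (induction m arbitrary: a b c rule: multiset_induct_remove_max)
  case empty
  then have "a = 0" "b = 0" "c = 0" by auto
  moreover have "columns3 0 0 0 = {}" by (simp add: columns3_def)
  moreover have "ssyt {} {#} = {\<lambda>_. undefined}" by (auto simp: ssyt_def)
  ultimately show ?case
    by (simp add: ssyt_columns_count_def content_kostka_def values_of_mult_def col_kostka_def)
next
  case (add m M x)
  let ?m = "m + replicate_mset x M"
  note IH = add.IH
  have M: "M \<notin># m" using add.hyps(1)[of M] by auto
  show ?case
  proof (cases "b = a + 1")
    \<comment> \<open>The boundary case: the count is 0 by default, the closed formula because it
      degenerates.\<close>
    case True
    have "content_kostka b c ?m = 0"
    proof (cases "\<forall>v. count ?m v \<le> 3")
      case bounded: True
      show ?thesis
        unfolding content_kostka_def if_P[OF bounded]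
        by (rule col_kostka_degenerate[OF add.prems(1)])
          (use size_eq_sum_mult[OF bounded] add.prems(2) True in linarith)
    qed (simp only: content_kostka_def if_False)
    then show ?thesis using True by (simp add: ssyt_columns_count_def)
  next
    case False
    then have ba: "b \<le> a" using add.prems(3) by simp
    have cb: "c \<le> b" using add.prems(1) by (auto simp: col_shapes_def)
    \<comment> \<open>With \<open>a = 0\<close> all columns would be empty, but the content has
      \<open>x > 0\<close> copies of \<open>M\<close>.\<close>
    have "a \<noteq> 0" using add.prems(2) add.hyps(2) ba cb by auto
    then obtain a0 where a0: "a = Suc a0" by (cases a) auto
    have rec: "ssyt_columns_count (Suc a0) b c ?m
       = (\<Sum>a'\<in>{a0, Suc a0}. \<Sum>b'\<in>{b - 1, b}. \<Sum>c'\<in>{c - 1, c}.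
            if c' \<le> b' \<and> a' + b' + c' + x = Suc a0 + b + c then ssyt_columns_count a' b' c' m else 0)"
      by (rule ssyt_columns_count_remove_max) (use ba cb add.hyps(1) a0 in auto)
    have sz: "size m + x = Suc a0 + b + c" using add.prems(2) a0 by simp
    have kostka: "content_kostka b c ?m = (if x \<le> 3 \<and> (\<forall>v. count m v \<le> 3) then
        col_kostka b c (card (values_of_mult 1 m) + (if 1 = x then 1 else 0))
          (card (values_of_mult 2 m) + (if 2 = x then 1 else 0))
          (card (values_of_mult 3 m) + (if 3 = x then 1 else 0)) else 0)"
      by (simp only: content_kostka_def all_count_le_add_iff[OF M]
          card_values_of_mult_add[OF M add.hyps(2)] zero_less_numeral zero_less_one)
    consider "x = 1" | "x = 2" | "x = 3" | "x \<ge> 4" using add.hyps(2) by linarith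
    then show ?thesis
    proof cases
      case 1
      have sz': "size m = a0 + b + c" using sz 1 by simp
      show ?thesis
        using add.prems(1) ba sz' unfolding kostka a0 unfolding rec unfolding 1 col_shapes_def
        by (elim insertE emptyE;
            simp add: IH col_shapes_def content_kostka_def[of _ _ m] col_kostka_add_single)
    next
      case 2
      have sz': "size m + 1 = a0 + b + c" using sz 2 by simp
      show ?thesis
        using add.prems(1) ba sz' unfolding kostka a0 unfolding rec unfolding 2 col_shapes_def
        by (elim insertE emptyE;
            simp add: IH col_shapes_def content_kostka_def[of _ _ m] col_kostka_add_double)
    next
      case 3
      have sz': "size m + 2 = a0 + b + c" using sz 3 by simp
      show ?thesis
        using add.prems(1) ba sz' unfolding kostka a0 unfolding rec unfolding 3 col_shapes_def
        by (elim insertE emptyE;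
            simp add: IH col_shapes_def content_kostka_def[of _ _ m] col_kostka_add_triple)
    next
      case 4
      \<comment> \<open>Three columns lose at most three cells, so every summand fails its size
        condition.\<close>
      have "ssyt_columns_count (Suc a0) b c ?m = 0"
        unfolding rec by (intro sum.neutral ballI if_not_P) (use 4 in auto)
      then show ?thesis
        unfolding kostka a0 using 4 by simp
    qed
  qed
qed

section \<open>Proper colorings of the blown-up fork\<close>

text \<open>
  The possible colors of \<open>u, v, x, y\<close> in a proper coloring with content \<open>m\<close>; the remaining colors
  are then used once each on the clique, in any order.
\<close>

definition outer_colors :: "nat multiset \<Rightarrow> (nat \<times> nat \<times> nat \<times> nat) set" where
  "outer_colors m = {(u, v, x, y). u \<noteq> v \<and> {#u, v, x, y#} \<subseteq># m \<and>
     (\<forall>c. count (m - {#u, v, x, y#}) c \<le> 1) \<and> {v, x, y} \<inter> set_mset (m - {#u, v, x, y#}) = {}}"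

lemma finite_outer_colors: "finite (outer_colors m)"
proof (rule finite_subset)
  show "outer_colors m \<subseteq> set_mset m \<times> set_mset m \<times> set_mset m \<times> set_mset m"
    by (auto simp: outer_colors_def dest: mset_subset_eqD)
qed simp

abbreviation (input) blown_up_fork :: "nat \<Rightarrow> (fork_vertex + nat) ugraph" where
  "blown_up_fork k \<equiv> replace_by_clique fork_graph fork_w k"

lemma verts_blown_up_fork:
  "verts (blown_up_fork k) = {Inl fork_u, Inl fork_v, Inl fork_x, Inl fork_y} \<union> Inr ` {..k}"
  by (auto simp: verts_def replace_by_clique_def fork_graph_def)

lemma edges_blown_up_fork:
  "edges (blown_up_fork k) = {{Inl fork_u, Inl fork_v}}
     \<union> {{Inl a, Inr i} | a i. a \<in> {fork_v, fork_x, fork_y} \<and> i \<le> k}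
     \<union> {{Inr i, Inr j} | i j. i \<le> k \<and> j \<le> k \<and> i \<noteq> j}"
proof -
  have "{{Inl a, Inl b} | a b. {a, b} \<in> edges fork_graph \<and> a \<noteq> fork_w \<and> b \<noteq> fork_w}
      = {{Inl fork_u, Inl fork_v :: fork_vertex + nat}}"
    by (auto simp: edges_def fork_graph_def doubleton_eq_iff)
  moreover have "{a, fork_w} \<in> edges fork_graph \<and> a \<noteq> fork_w \<longleftrightarrow> a \<in> {fork_v, fork_x, fork_y}" for a
    by (auto simp: edges_def fork_graph_def doubleton_eq_iff)
  then have "{{Inl a, Inr i} | a i. {a, fork_w} \<in> edges fork_graph \<and> a \<noteq> fork_w \<and> i \<le> k}
      = {{Inl a, Inr i :: fork_vertex + nat} | a i. a \<in> {fork_v, fork_x, fork_y} \<and> i \<le> k}"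
    by blast
  ultimately show ?thesis
    by (simp only: replace_by_clique_def edges_def snd_conv)
qed

lemma proper_coloring_blown_up_fork:
  "proper_coloring (blown_up_fork k) \<kappa> \<longleftrightarrow>
     \<kappa> \<in> verts (blown_up_fork k) \<rightarrow>\<^sub>E {1..} \<and> \<kappa> (Inl fork_u) \<noteq> \<kappa> (Inl fork_v) \<and>
     inj_on (\<lambda>i. \<kappa> (Inr i)) {..k} \<and>
     (\<forall>i\<le>k. \<kappa> (Inr i) \<notin> {\<kappa> (Inl fork_v), \<kappa> (Inl fork_x), \<kappa> (Inl fork_y)})"
  (is "?L \<longleftrightarrow> ?R")
proof
  assume ?L
  then have *: "\<kappa> a \<noteq> \<kappa> b" if "{a, b} \<in> edges (blown_up_fork k)" for a b
    using that by (auto simp: proper_coloring_def)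
  have "{Inl fork_u, Inl fork_v} \<in> edges (blown_up_fork k)"
    by (simp add: edges_blown_up_fork)
  moreover have "{Inr i, Inr j} \<in> edges (blown_up_fork k)" if "i \<le> k" "j \<le> k" "i \<noteq> j" for i j
    using that unfolding edges_blown_up_fork by blast
  moreover have "{Inl a, Inr i} \<in> edges (blown_up_fork k)"
    if "i \<le> k" "a \<in> {fork_v, fork_x, fork_y}" for a i
    using that unfolding edges_blown_up_fork by blast
  ultimately show ?R
    using \<open>?L\<close> * unfolding proper_coloring_def inj_on_def
    by (metis atMost_iff insertE insertI1 insertI2 singletonD)
next
  assume R: ?R
  have "\<kappa> a \<noteq> \<kappa> b" if "{a, b} \<in> edges (blown_up_fork k)" for a b
    using that R unfolding edges_blown_up_fork
    by (auto simp: doubleton_eq_iff inj_on_def)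
  with R show ?L by (auto simp: proper_coloring_def)
qed

lemma mset_set_verts_blown_up_fork:
  "mset_set (verts (blown_up_fork k)) = {#Inl fork_u, Inl fork_v, Inl fork_x, Inl fork_y#}
     + image_mset Inr (mset_set {..k})"
proof -
  have "mset_set (verts (blown_up_fork k))
      = mset_set {Inl fork_u, Inl fork_v, Inl fork_x, Inl fork_y} + mset_set (Inr ` {..k})"
    unfolding verts_blown_up_fork by (intro mset_set_Union) auto
  then show ?thesis
    by (simp add: image_mset_mset_set)
qed

lemma mset_set_set_mset_eq:
  assumes "\<forall>c. count W c \<le> 1"
  shows "mset_set (set_mset W) = W"
proof (rule multiset_eqI)
  fix c
  show "count (mset_set (set_mset W)) c = count W c"
    using assms[rule_format, of c] by (cases "count W c") (auto simp: count_mset_set' intro: count_inI simp flip: not_in_iff)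
qed

lemma card_inj_to_equal_card:
  assumes "finite C" "card C = card A" "finite A"
  shows "card {g \<in> A \<rightarrow>\<^sub>E C. inj_on g A} = fact (card A)"
  using card_inj_on_subset_funcset[OF assms(3,1) subset_refl] assms
  by (simp add: fact_prod_rev)

text \<open>Once the outer colors are chosen, the content leaves a set of \<open>k + 1\<close>
  colors for the clique, and its bijections onto that set number \<open>(k + 1)!\<close> whatever
  the choice was.\<close>

lemma chromatic_sym_blown_up_fork:
  assumes m0: "0 \<notin># m" and sz: "size m = k + 5"
  shows "chromatic_sym (blown_up_fork k) m = fact (k + 1) * of_nat (card (outer_colors m))"
proof -
  let ?V = "verts (blown_up_fork k)"
  let ?rest = "\<lambda>(u, v, x, y). m - {#u, v, x, y#}"
  let ?F = "\<lambda>q. {g \<in> {..k} \<rightarrow>\<^sub>E set_mset (?rest q). inj_on g {..k}}"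
  let ?C = "{\<kappa>. proper_coloring (blown_up_fork k) \<kappa> \<and> image_mset \<kappa> (mset_set ?V) = m}"
  let ?f = "\<lambda>\<kappa> :: fork_vertex + nat \<Rightarrow> nat.
    ((\<kappa> (Inl fork_u), \<kappa> (Inl fork_v), \<kappa> (Inl fork_x), \<kappa> (Inl fork_y)), \<lambda>i\<in>{..k}. \<kappa> (Inr i))"
  \<comment> \<open>The value \<open>undefined\<close> at \<open>fork_w\<close> and at indices above
    \<open>k\<close> makes the coloring extensional.\<close>
  let ?h = "\<lambda>((u, v, x, y), g). case_sum
    (case_fork_vertex u v undefined x y) (\<lambda>i. if i \<le> k then g i else undefined)"
  have content: "image_mset \<kappa> (mset_set ?V)
      = {#\<kappa> (Inl fork_u), \<kappa> (Inl fork_v), \<kappa> (Inl fork_x), \<kappa> (Inl fork_y)#}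
        + mset_set ((\<lambda>i. \<kappa> (Inr i)) ` {..k})"
    if "inj_on (\<lambda>i. \<kappa> (Inr i)) {..k}" for \<kappa> :: "fork_vertex + nat \<Rightarrow> nat"
    using image_mset_mset_set[OF that]
    by (simp add: mset_set_verts_blown_up_fork multiset.map_comp comp_def)
  have rest: "card (set_mset (?rest q)) = k + 1" "mset_set (set_mset (?rest q)) = ?rest q"
    if q: "q \<in> outer_colors m" for q
  proof -
    obtain u v x y where q': "q = (u, v, x, y)" by (cases q) auto
    show eq: "mset_set (set_mset (?rest q)) = ?rest q"
      using q by (intro mset_set_set_mset_eq) (auto simp: q' outer_colors_def)
    have "size (?rest q) = k + 1"
      using q sz by (simp add: q' outer_colors_def size_Diff_submset)
    then show "card (set_mset (?rest q)) = k + 1"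
      using arg_cong[OF eq, of size] by simp
  qed
  have fwd: "?f \<kappa> \<in> Sigma (outer_colors m) ?F" if \<kappa>: "\<kappa> \<in> ?C" for \<kappa>
  proof -
    let ?W = "(\<lambda>i. \<kappa> (Inr i)) ` {..k}"
    let ?q = "{#\<kappa> (Inl fork_u), \<kappa> (Inl fork_v), \<kappa> (Inl fork_x), \<kappa> (Inl fork_y)#}"
    have proper: "\<kappa> (Inl fork_u) \<noteq> \<kappa> (Inl fork_v)" "inj_on (\<lambda>i. \<kappa> (Inr i)) {..k}"
      "\<forall>i\<le>k. \<kappa> (Inr i) \<notin> {\<kappa> (Inl fork_v), \<kappa> (Inl fork_x), \<kappa> (Inl fork_y)}"
      using \<kappa> by (auto simp: proper_coloring_blown_up_fork)
    have m: "m = ?q + mset_set ?W"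
      using content[OF proper(2)] \<kappa> by simp
    have diff: "m - ?q = mset_set ?W"
      unfolding m by (rule add_diff_cancel_left')
    have "fst (?f \<kappa>) \<in> outer_colors m"
      unfolding outer_colors_def fst_conv mem_Collect_eq case_prod_conv diff
    proof (intro conjI)
      show "?q \<subseteq># m" unfolding m by (rule mset_subset_eq_add_left)
      show "\<forall>c. count (mset_set ?W) c \<le> 1" by (simp add: count_mset_set')
      show "{\<kappa> (Inl fork_v), \<kappa> (Inl fork_x), \<kappa> (Inl fork_y)} \<inter> set_mset (mset_set ?W) = {}"
        using proper(3) by auto
    qed (fact proper(1))
    moreover have "snd (?f \<kappa>) \<in> ?F (fst (?f \<kappa>))"
      using proper(2) by (auto simp: diff inj_on_def)
    ultimately show ?thesis by (simp only: mem_Sigma_iff fst_conv snd_conv)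
  qed
  have bwd: "?h p \<in> ?C" if mem: "p \<in> Sigma (outer_colors m) ?F" for p
  proof -
    obtain u v x y g where p: "p = ((u, v, x, y), g)"
      and q: "(u, v, x, y) \<in> outer_colors m" and g: "g \<in> ?F (u, v, x, y)"
      using mem by (cases p) auto
    let ?W = "set_mset (m - {#u, v, x, y#})"
    have gW: "g ` {..k} \<subseteq> ?W" and inj: "inj_on g {..k}" using g by auto
    \<comment> \<open>An injection between finite sets of equal size is onto, so the clique uses up
      exactly the remaining colors.\<close>
    have "g ` {..k} = ?W"
      using rest(1)[OF q] card_image[OF inj] by (intro card_subset_eq gW) auto
    moreover have "(\<lambda>i. ?h p (Inr i)) ` {..k} = g ` {..k}" by (auto simp: p)
    moreover have inj': "inj_on (\<lambda>i. ?h p (Inr i)) {..k}"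
      using inj by (auto simp: p inj_on_def)
    ultimately have "image_mset (?h p) (mset_set ?V) = {#u, v, x, y#} + (m - {#u, v, x, y#})"
      using content[OF inj'] rest(2)[OF q] by (simp add: p)
    also have "\<dots> = m"
      by (rule subset_mset.add_diff_inverse) (use q in \<open>simp add: outer_colors_def\<close>)
    finally have m: "image_mset (?h p) (mset_set ?V) = m" .
    have fin: "finite ?V" by (simp add: verts_blown_up_fork)
    have "?h p z \<ge> 1" if "z \<in> ?V" for z
    proof -
      have "?h p z \<in># image_mset (?h p) (mset_set ?V)"
        using that fin by (intro imageI[THEN in_image_mset[THEN iffD2]]) auto
      then show ?thesis using m m0 by (cases "?h p z") auto
    qed
    moreover have "?h p \<in> extensional ?V"
      by (auto simp: p extensional_def verts_blown_up_fork split: sum.split fork_vertex.split)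
    moreover have "\<forall>i\<le>k. g i \<notin> {v, x, y}"
      using gW q by (auto simp: outer_colors_def)
    ultimately have "proper_coloring (blown_up_fork k) (?h p)"
      using q inj' unfolding proper_coloring_blown_up_fork
      by (auto simp: PiE_def p outer_colors_def)
    with m show ?thesis by simp
  qed
  have hf: "?h (?f \<kappa>) = \<kappa>" if "\<kappa> \<in> ?C" for \<kappa>
  proof
    fix z
    have "\<kappa> \<in> extensional ?V"
      using that by (auto simp: proper_coloring_def PiE_def)
    then show "?h (?f \<kappa>) z = \<kappa> z"
      by (auto simp: extensional_def verts_blown_up_fork split: sum.split fork_vertex.split)
  qed
  have fh: "?f (?h p) = p" if "p \<in> Sigma (outer_colors m) ?F" for p
    using that by (auto simp: PiE_def extensional_def fun_eq_iff)
  have "bij_betw ?f ?C (Sigma (outer_colors m) ?F)"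
  proof (rule bij_betw_byWitness[where f' = ?h])
    show "\<forall>\<kappa>\<in>?C. ?h (?f \<kappa>) = \<kappa>" using hf by (intro ballI)
    show "\<forall>p\<in>Sigma (outer_colors m) ?F. ?f (?h p) = p" using fh by (intro ballI)
    show "?f ` ?C \<subseteq> Sigma (outer_colors m) ?F" using fwd by (intro image_subsetI)
    show "?h ` Sigma (outer_colors m) ?F \<subseteq> ?C" using bwd by (intro image_subsetI)
  qed
  then have "card ?C = card (Sigma (outer_colors m) ?F)"
    by (rule bij_betw_same_card)
  also have "\<dots> = (\<Sum>q\<in>outer_colors m. card (?F q))"
  proof (rule card_SigmaI[OF finite_outer_colors])
    show "\<forall>q\<in>outer_colors m. finite (?F q)"
      by (auto intro!: finite_subset[of "?F _"] finite_PiE)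
  qed
  also have "\<dots> = (\<Sum>q\<in>outer_colors m. fact (k + 1))"
    using rest(1) by (intro sum.cong refl) (simp add: card_inj_to_equal_card[where A = "{..k}", simplified])
  finally have "card ?C = fact (k + 1) * card (outer_colors m)"
    by (simp only: sum_constant mult.commute of_nat_id)
  then show ?thesis
    by (simp only: chromatic_sym_def of_nat_mult of_nat_fact)
qed

section \<open>Admissible outer colors in terms of multiplicities\<close>

text \<open>The vertices v, x, y are adjacent to the whole clique, so their colors have all
  occurrences among the four outer vertices. Only the color of u may recur in the clique, once; any
  other color is confined to the clique and occurs at most once.\<close>

lemma mem_outer_colors_iff:
  "(u, v, x, y) \<in> outer_colors m \<longleftrightarrow> u \<noteq> v \<and>
     (\<forall>c\<in>{v, x, y}. count m c = count {#u, v, x, y#} c) \<and>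
     count m u \<in> {count {#u, v, x, y#} u, count {#u, v, x, y#} u + 1} \<and>
     (\<forall>c. c \<notin> {u, v, x, y} \<longrightarrow> count m c \<le> 1)"
  (is "?L \<longleftrightarrow> ?R")
proof
  let ?q = "{#u, v, x, y#}"
  assume L: ?L
  then have le: "count ?q c \<le> count m c" and le1: "count m c - count ?q c \<le> 1" for c
    unfolding outer_colors_def by (auto simp: subseteq_mset_def simp del: count_add_mset)
  have "c \<notin># m - ?q" if "c \<in> {v, x, y}" for c
    using L that unfolding outer_colors_def by blast
  then have "count (m - ?q) c = 0" if "c \<in> {v, x, y}" for c
    using that by (simp only: not_in_iff)
  then have "count m c = count ?q c" if "c \<in> {v, x, y}" for c
    using that le[of c] unfolding count_diff by (meson diff_is_0_eq le_antisym)
  moreover have "count m u \<in> {count ?q u, count ?q u + 1}"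
    using le[of u] le1[of u] by (auto simp del: count_add_mset)
  moreover have "count m c \<le> 1" if "c \<notin> {u, v, x, y}" for c
    using le1[of c] that by auto
  moreover have "u \<noteq> v" using L by (simp add: outer_colors_def)
  ultimately show ?R by blast
next
  let ?q = "{#u, v, x, y#}"
  assume R: ?R
  have *: "count ?q c \<le> count m c \<and> count m c - count ?q c \<le> 1" for c
  proof (cases "c \<in> {u, v, x, y}")
    case True
    then show ?thesis using R by (auto simp del: count_add_mset)
  next
    case False
    then show ?thesis using R by auto
  qed
  then have "?q \<subseteq># m" "\<forall>c. count (m - ?q) c \<le> 1"
    by (auto simp: subseteq_mset_def simp del: count_add_mset)
  moreover have "c \<notin># m - ?q" if "c \<in> {v, x, y}" for c
    using R that by (simp only: not_in_iff count_diff)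
  ultimately show ?L
    using R unfolding outer_colors_def by blast
qed

lemma outer_colors_subset:
  assumes "(u, v, x, y) \<in> outer_colors m"
  shows "{u, v, x, y} \<subseteq> set_mset m"
  using assms by (auto simp: outer_colors_def dest: mset_subset_eqD)

text \<open>A repeated color must occur among u, v, x, y, and its multiplicity depends only on which
  of these four colors coincide and whether that of u recurs in the clique. Running through these
  patterns leaves five types; three doubled colors never occur, since at most five vertices can
  share a color with another vertex.\<close>

lemma outer_colors_type:
  assumes "(u, v, x, y) \<in> outer_colors m"
  shows "\<forall>c. count m c \<le> 3"
    and "(card (values_of_mult 2 m), card (values_of_mult 3 m)) \<in> {(0, 0), (1, 0), (2, 0), (0, 1), (1, 1)}"
proof -
  note * = assms[unfolded mem_outer_colors_iff]
  have occ: "count {#u, v, x, y#} c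
      = of_bool (u = c) + of_bool (v = c) + of_bool (x = c) + of_bool (y = c)" for c
    by (simp add: of_bool_def)
  have uv: "u \<noteq> v" and cnt: "\<And>c. c \<in> {v, x, y} \<Longrightarrow> count m c = count {#u, v, x, y#} c"
    and others: "\<And>c. c \<notin> {u, v, x, y} \<Longrightarrow> count m c \<le> 1"
    using * by blast+
  have v: "count m v = 1 + of_bool (x = v) + of_bool (y = v)"
    and x: "count m x = 1 + of_bool (x = u) + of_bool (x = v) + of_bool (x = y)"
    and y: "count m y = 1 + of_bool (y = u) + of_bool (y = v) + of_bool (x = y)"
    using uv cnt[of v] cnt[of x] cnt[of y] by (simp_all add: occ eq_commute del: count_add_mset)
  \<comment> \<open>If x or y shares the color of u, the clique cannot use that color; otherwise it
    may use it once.\<close>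
  have u: "count m u = 1 + of_bool (x = u) + of_bool (y = u) \<or> count m u = 2 \<and> x \<noteq> u \<and> y \<noteq> u"
  proof (cases "x = u \<or> y = u")
    case True
    then have "count m u = count {#u, v, x, y#} u" using cnt[of u] by auto
    then show ?thesis using uv by (simp add: occ del: count_add_mset)
  next
    case False
    moreover have "count m u = count {#u, v, x, y#} u \<or> count m u = count {#u, v, x, y#} u + 1"
      using * by blast
    ultimately show ?thesis using uv by (simp add: occ numeral_2_eq_2 del: count_add_mset)
  qed
  have vals: "values_of_mult i m = (if count m u = i then {u} else {}) \<union>
      (if count m v = i then {v} else {}) \<union> (if count m x = i then {x} else {}) \<union>
      (if count m y = i then {y} else {})" if "i \<ge> 2" for i
  proof -
    have "c \<in> {u, v, x, y}" if "count m c = i" for c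
      using others[of c] that \<open>i \<ge> 2\<close> by linarith
    then show ?thesis by (auto simp: values_of_mult_def)
  qed
  have vals2: "values_of_mult 2 m = (if count m u = 2 then {u} else {}) \<union>
      (if count m v = 2 then {v} else {}) \<union> (if count m x = 2 then {x} else {}) \<union>
      (if count m y = 2 then {y} else {})"
    and vals3: "values_of_mult 3 m = (if count m u = 3 then {u} else {}) \<union>
      (if count m v = 3 then {v} else {}) \<union> (if count m x = 3 then {x} else {}) \<union>
      (if count m y = 3 then {y} else {})"
    by (rule vals, simp)+
  have "count m c \<le> 3" if "c \<in> {u, v, x, y}" for c
    using * that by (auto split: if_splits)
  moreover have "count m c \<le> 3" if "c \<notin> {u, v, x, y}" for c
    using others[OF that] by simp
  ultimately show "\<forall>c. count m c \<le> 3" by blast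
  from u show "(card (values_of_mult 2 m), card (values_of_mult 3 m)) \<in> {(0, 0), (1, 0), (2, 0), (0, 1), (1, 1)}"
  proof
    assume u: "count m u = 1 + of_bool (x = u) + of_bool (y = u)"
    show ?thesis
      unfolding vals2 vals3
      by (cases "x = y"; cases "x = u"; cases "x = v"; cases "y = u"; cases "y = v";
          simp add: u v x y uv card_insert_if)
  next
    assume u: "count m u = 2 \<and> x \<noteq> u \<and> y \<noteq> u"
    then show ?thesis
      unfolding vals2 vals3
      by (cases "x = y"; cases "x = v"; cases "y = v"; simp add: v x y uv card_insert_if)
  qed
qed

section \<open>Counting the admissible outer colors for each type of content\<close>

lemma card_pairs:
  assumes "finite S"
  shows "card (SIGMA a:S. S - {a}) = card S * (card S - 1)"
  using assms by simp

lemma card_triples: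
  assumes "finite S"
  shows "card (SIGMA a:S. SIGMA b:S - {a}. S - {a, b}) = card S * (card S - 1) * (card S - 2)"
proof -
  have "card (SIGMA b:S - {a}. S - {a, b}) = (card S - 1) * (card S - 2)" if "a \<in> S" for a
  proof -
    have "card (S - {a, b}) = card S - 2" if "b \<in> S - {a}" for b
      using assms that \<open>a \<in> S\<close> by (subst card_Diff_subset) auto
    then have "(\<Sum>b\<in>S - {a}. card (S - {a, b})) = (\<Sum>b\<in>S - {a}. card S - 2)"
      by (intro sum.cong) auto
    then show ?thesis using assms \<open>a \<in> S\<close> by simp
  qed
  then have "(\<Sum>a\<in>S. card (SIGMA b:S - {a}. S - {a, b})) = (\<Sum>a\<in>S. (card S - 1) * (card S - 2))"
    by (intro sum.cong) auto
  moreover have "card (SIGMA a:S. SIGMA b:S - {a}. S - {a, b})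
      = (\<Sum>a\<in>S. card (SIGMA b:S - {a}. S - {a, b}))"
    using assms by (intro card_SigmaI) auto
  ultimately show ?thesis by simp
qed

lemma card_quadruples:
  assumes "finite S"
  shows "card (SIGMA a:S. SIGMA b:S - {a}. SIGMA c:S - {a, b}. S - {a, b, c})
    = card S * (card S - 1) * (card S - 2) * (card S - 3)"
proof -
  have "card (SIGMA b:S - {a}. SIGMA c:S - {a, b}. S - {a, b, c})
      = (card S - 1) * (card S - 2) * (card S - 3)" if "a \<in> S" for a
  proof -
    \<comment> \<open>With the first entry fixed, ordered triples of distinct elements of
      \<open>S - {a}\<close> remain.\<close>
    have "(SIGMA b:S - {a}. SIGMA c:S - {a, b}. S - {a, b, c})
        = (SIGMA b:S - {a}. SIGMA c:(S - {a}) - {b}. (S - {a}) - {b, c})"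
      by auto
    moreover have "card \<dots> = card (S - {a}) * (card (S - {a}) - 1) * (card (S - {a}) - 2)"
      using assms by (intro card_triples) simp
    ultimately show ?thesis
      using assms that by (simp add: numeral_eq_Suc)
  qed
  then have "(\<Sum>a\<in>S. card (SIGMA b:S - {a}. SIGMA c:S - {a, b}. S - {a, b, c}))
      = (\<Sum>a\<in>S. (card S - 1) * (card S - 2) * (card S - 3))"
    by (intro sum.cong) auto
  moreover have "card (SIGMA a:S. SIGMA b:S - {a}. SIGMA c:S - {a, b}. S - {a, b, c})
      = (\<Sum>a\<in>S. card (SIGMA b:S - {a}. SIGMA c:S - {a, b}. S - {a, b, c}))"
    using assms by (intro card_SigmaI) auto
  ultimately show ?thesis by simp
qed

lemma card_image_Un:
  assumes "finite A" "finite B" "inj_on f A" "f ` A \<inter> B = {}"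
  shows "card (f ` A \<union> B) = card A + card B"
  using assms by (simp add: card_Un_disjoint card_image)

context
  fixes m :: "nat multiset" and S S2 S3 :: "nat set"
  assumes le3: "\<forall>v. count m v \<le> 3"
  defines "S \<equiv> values_of_mult 1 m" and "S2 \<equiv> values_of_mult 2 m" and "S3 \<equiv> values_of_mult 3 m"
begin

lemma count_by_values:
  "count m c = (if c \<in> S then 1 else if c \<in> S2 then 2 else if c \<in> S3 then 3 else 0)"
  using le3[rule_format, of c] by (auto simp: S_def S2_def S3_def values_of_mult_def)

lemma values_disjoint: "c \<in> S \<Longrightarrow> c \<notin> S2" "c \<in> S \<Longrightarrow> c \<notin> S3" "c \<in> S2 \<Longrightarrow> c \<notin> S3"
  by (auto simp: S_def S2_def S3_def values_of_mult_def)

lemma mem_outer_colors_iff_values: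
  "(u, v, x, y) \<in> outer_colors m \<longleftrightarrow> u \<noteq> v \<and>
     (\<forall>c\<in>{v, x, y}. count m c = count {#u, v, x, y#} c) \<and>
     count m u \<in> {count {#u, v, x, y#} u, count {#u, v, x, y#} u + 1} \<and>
     S2 \<subseteq> {u, v, x, y} \<and> S3 \<subseteq> {u, v, x, y}"
proof -
  have "count m c \<le> 1 \<longleftrightarrow> c \<notin> S2 \<and> c \<notin> S3" for c
    using le3[rule_format, of c] by (auto simp: S2_def S3_def values_of_mult_def)
  then show ?thesis unfolding mem_outer_colors_iff by blast
qed

lemma finite_S: "finite S"
  by (simp add: S_def finite_values_of_mult)

lemma card_outer_colors_type_0_0:
  assumes "S2 = {}" "S3 = {}"
  shows "card (outer_colors m) = card S * (card S - 1) * (card S - 2) * (card S - 3)"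
proof -
  have "outer_colors m = (SIGMA a:S. SIGMA b:S - {a}. SIGMA c:S - {a, b}. S - {a, b, c})"
    using assms by (auto simp: mem_outer_colors_iff_values count_by_values split: if_splits)
  then show ?thesis by (simp only: card_quadruples[OF finite_S])
qed

text \<open>The doubled color \<open>D\<close> is either shared by u and a clique vertex, which
  leaves an ordered triple for v, x, y, or by one of the five non-adjacent pairs ux, uy, vx, vy, xy,
  which leaves an ordered pair.\<close>

lemma card_outer_colors_type_1_0:
  assumes "S2 = {D}" "S3 = {}"
  shows "card (outer_colors m) = card S * (card S - 1) * (card S - 2) + 5 * (card S * (card S - 1))"
proof -
  let ?P = "SIGMA a:S. S - {a}"
  have D: "D \<notin> S" using assms values_disjoint by blast
  have eq: "outer_colors m = Pair D ` (SIGMA a:S. SIGMA b:S - {a}. S - {a, b})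
      \<union> ((\<lambda>(a, b). (D, a, D, b)) ` ?P \<union> ((\<lambda>(a, b). (D, a, b, D)) ` ?P
      \<union> ((\<lambda>(a, b). (a, D, D, b)) ` ?P \<union> ((\<lambda>(a, b). (a, D, b, D)) ` ?P
      \<union> (\<lambda>(a, b). (a, b, D, D)) ` ?P))))" (is "_ = ?R")
  proof (rule set_eqI, simp only: split_paired_all)
    fix u v x y
    show "(u, v, x, y) \<in> outer_colors m \<longleftrightarrow> (u, v, x, y) \<in> ?R"
      using assms D
      by (cases "u = D"; cases "v = D"; cases "x = D"; cases "y = D")
        (auto simp: mem_outer_colors_iff_values count_by_values image_iff split: if_splits)
  qed
  have "card ?R = card S * (card S - 1) * (card S - 2) + 5 * card ?P"
  proof -
    have P: "finite ?P" using finite_S by simp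
    have "card ?R = card (SIGMA a:S. SIGMA b:S - {a}. S - {a, b})
        + (card ?P + (card ?P + (card ?P + (card ?P + card ?P))))"
      by (subst card_image_Un, use finite_S in simp, use finite_S in simp, simp add: inj_on_def,
          use D in force)
        ((subst card_image_Un, rule P, use finite_S in simp, force simp: inj_on_def, use D in force)+,
         subst card_image, force simp: inj_on_def, rule refl)
    then show ?thesis
      by (simp only: card_triples[OF finite_S])
  qed
  then show ?thesis by (simp only: eq card_pairs[OF finite_S])
qed

text \<open>If u shares its color with the clique, the other doubled color sits on vx, vy or xy and
  one color of \<open>S\<close> stays free: six families with the exchange of \<open>D\<close> and
  \<open>E\<close>. Otherwise the pairs are ux and vy, or uy and vx, giving four more
  tuples.\<close>

lemma card_outer_colors_type_2_0:
  assumes "S2 = {D, E}" "D \<noteq> E" "S3 = {}"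
  shows "card (outer_colors m) = 6 * card S + 4"
proof -
  have D: "D \<notin> S" "E \<notin> S" using assms values_disjoint by blast+
  have cD: "count m D = 2" and cE: "count m E = 2" and cS: "\<And>a. a \<in> S \<Longrightarrow> count m a = 1"
    using assms D by (auto simp: count_by_values)
  have ne: "a \<noteq> D" "D \<noteq> a" "a \<noteq> E" "E \<noteq> a" if "a \<in> S" for a
    using that D by auto
  have eq: "outer_colors m = (\<lambda>a. (D, E, E, a)) ` S \<union> ((\<lambda>a. (D, E, a, E)) ` S \<union> ((\<lambda>a. (D, a, E, E)) ` S
      \<union> ((\<lambda>a. (E, D, D, a)) ` S \<union> ((\<lambda>a. (E, D, a, D)) ` S \<union> ((\<lambda>a. (E, a, D, D)) ` S
      \<union> {(D, E, D, E), (D, E, E, D), (E, D, D, E), (E, D, E, D)})))))" (is "_ = ?R")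
  proof
    show "outer_colors m \<subseteq> ?R"
    proof (clarify del: UnCI)
      fix u v x y assume q: "(u, v, x, y) \<in> outer_colors m"
      then have uv: "u \<noteq> v" and cnt: "\<And>c. c \<in> {v, x, y} \<Longrightarrow> count m c = count {#u, v, x, y#} c"
        and DE: "D \<in> {u, v, x, y}" "E \<in> {u, v, x, y}"
        using assms unfolding mem_outer_colors_iff_values by blast+
      \<comment> \<open>A doubled color that u does not have is absent from the clique, so both its
        occurrences are among v, x, y.\<close>
      have two: "of_bool (u = c) + of_bool (v = c) + of_bool (x = c) + of_bool (y = c) = (2 :: nat)"
        if "c \<in> {D, E}" "c \<noteq> u" for c
      proof -
        have "count m c = 2" using that(1) cD cE by auto
        moreover have "c \<in> {v, x, y}" using that DE by auto
        moreover have "count {#u, v, x, y#} c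
            = of_bool (u = c) + of_bool (v = c) + of_bool (x = c) + of_bool (y = c)"
          by (simp add: of_bool_def)
        ultimately show ?thesis using cnt[of c] by presburger
      qed
      have val: "c = D \<or> c = E \<or> c \<in> S" if "c \<in> {v, x, y}" for c
      proof -
        have "count m c \<noteq> 0" using that outer_colors_subset[OF q] by auto
        then show ?thesis
          using assms by (auto simp: count_by_values split: if_splits)
      qed
      have two_of_three: "v = c \<and> x = c \<and> y \<noteq> c \<or> v = c \<and> y = c \<and> x \<noteq> c \<or> x = c \<and> y = c \<and> v \<noteq> c"
        if "c \<in> {D, E}" "c \<noteq> u" for c
        using two[OF that] that(2) by (cases "v = c"; cases "x = c"; cases "y = c"; simp)
      have vals: "v = D \<or> v = E \<or> v \<in> S" "x = D \<or> x = E \<or> x \<in> S" "y = D \<or> y = E \<or> y \<in> S"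
        by (rule val, simp)+
      consider "u = D" | "u = E" | "D \<noteq> u" "E \<noteq> u" by blast
      then show "(u, v, x, y) \<in> ?R"
      proof cases
        case 1
        then have "E \<noteq> u" using assms(2) by simp
        from two_of_three[OF _ this, simplified] 1 vals uv show ?thesis
          by (elim disjE conjE; simp add: image_iff)
      next
        case 2
        then have "D \<noteq> u" using assms(2) by simp
        from two_of_three[OF _ this, simplified] 2 vals uv show ?thesis
          by (elim disjE conjE; simp add: image_iff)
      next
        case 3
        \<comment> \<open>\<open>D\<close> and \<open>E\<close> would each need two of the three
          places v, x, y.\<close>
        have "False"
          using two_of_three[OF _ 3(1), simplified] two_of_three[OF _ 3(2), simplified] assms(2) by (elim disjE conjE; simp)
        then show ?thesis ..
      qed
    qed
    show "?R \<subseteq> outer_colors m"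
    proof -
      have "(D, E, E, a) \<in> outer_colors m" "(D, E, a, E) \<in> outer_colors m" "(D, a, E, E) \<in> outer_colors m"
        "(E, D, D, a) \<in> outer_colors m" "(E, D, a, D) \<in> outer_colors m" "(E, a, D, D) \<in> outer_colors m"
        if "a \<in> S" for a
        using that D assms by (simp_all add: mem_outer_colors_iff_values cD cE cS ne[OF that])
      moreover have "(D, E, D, E) \<in> outer_colors m" "(D, E, E, D) \<in> outer_colors m"
        "(E, D, D, E) \<in> outer_colors m" "(E, D, E, D) \<in> outer_colors m"
        using assms by (simp_all add: mem_outer_colors_iff_values cD cE)
      ultimately show ?thesis by (intro Un_least image_subsetI) simp_all
    qed
  qed
  have "card ?R = 6 * card S + 4"
  proof -
    have "card ?R = card S + (card S + (card S + (card S + (card S + (card S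
        + card {(D, E, D, E), (D, E, E, D), (E, D, D, E), (E, D, E, D)})))))"
      by ((subst card_image_Un, rule finite_S, use finite_S in simp, simp add: inj_on_def,
          use D assms(2) in force)+, rule refl)
    then show ?thesis using assms(2) by simp
  qed
  then show ?thesis by (simp only: eq)
qed

text \<open>The only independent triples of vertices are uxy and vxy; the remaining outer vertex
  takes any color of \<open>S\<close>.\<close>

lemma card_outer_colors_type_0_1:
  assumes "S2 = {}" "S3 = {T}"
  shows "card (outer_colors m) = 2 * card S"
proof -
  have T: "T \<notin> S" using assms values_disjoint by blast
  have "outer_colors m = (\<lambda>a. (T, a, T, T)) ` S \<union> (\<lambda>a. (a, T, T, T)) ` S" (is "_ = ?R")
  proof (rule set_eqI, simp only: split_paired_all)
    fix u v x y
    show "(u, v, x, y) \<in> outer_colors m \<longleftrightarrow> (u, v, x, y) \<in> ?R"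
      using assms T
      by (cases "u = T"; cases "v = T"; cases "x = T"; cases "y = T")
        (auto simp: mem_outer_colors_iff_values count_by_values image_iff split: if_splits)
  qed
  also have "card \<dots> = 2 * card S"
    using finite_S T by (subst card_Un_disjoint) (auto simp: card_image inj_on_def)
  finally show ?thesis .
qed

text \<open>The triple must be vxy, with u and a clique vertex as the pair: if it were uxy, v would
  be left without a non-adjacent partner.\<close>

lemma card_outer_colors_type_1_1:
  assumes "S2 = {D}" "S3 = {T}"
  shows "card (outer_colors m) = 1"
proof -
  have T: "T \<notin> S" "D \<notin> S" "D \<noteq> T" using assms values_disjoint by blast+
  have "outer_colors m = {(D, T, T, T)}" (is "_ = ?R")
  proof (rule set_eqI, simp only: split_paired_all)
    fix u v x y
    show "(u, v, x, y) \<in> outer_colors m \<longleftrightarrow> (u, v, x, y) \<in> ?R"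
      using assms T
      by (cases "u = T"; cases "v = T"; cases "x = T"; cases "y = T"; cases "u = D")
        (auto simp: mem_outer_colors_iff_values count_by_values split: if_splits)
  qed
  then show ?thesis by simp
qed

end

section \<open>The Schur expansion\<close>

lemma outer_colors_type_cases:
  assumes "outer_colors m \<noteq> {}"
  shows "\<forall>c. count m c \<le> 3"
    and "(card (values_of_mult 2 m), card (values_of_mult 3 m)) \<in> {(0, 0), (1, 0), (2, 0), (0, 1), (1, 1)}"
  using assms outer_colors_type by (metis ex_in_conv prod_cases4)+

text \<open>The expansion at content \<open>m\<close>, divided by \<open>(k + 1)!\<close>. For each
  of the five possible types the size expresses \<open>s\<close> through \<open>k\<close>, and a
  polynomial identity in \<open>k\<close> remains; for all other contents both sides are 0.\<close>

lemma card_outer_colors_eq: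
  assumes sz: "size m = k + 5"
  shows "of_nat (card (outer_colors m)) = content_kostka 2 1 m + (of_nat k + 3) * content_kostka 1 1 m
      - 2 * content_kostka 3 0 m + 5 * (of_nat k + 1) * content_kostka 2 0 m
      + (of_nat k ^ 3 + 5 * of_nat k ^ 2 + 14 * of_nat k + 14) * content_kostka 1 0 m
      + 2 * (of_nat k + 2) ^ 3 * content_kostka 0 0 m"
  (is "_ = ?R")
proof (cases "\<forall>c. count m c \<le> 3")
  case False
  then have "outer_colors m = {}" using outer_colors_type_cases(1) by blast
  moreover have "content_kostka b c m = 0" for b c
    unfolding content_kostka_def using False by (rule if_not_P)
  ultimately show ?thesis by simp
next
  case le3: True
  define s d t where std: "s = card (values_of_mult 1 m)" "d = card (values_of_mult 2 m)"
    "t = card (values_of_mult 3 m)"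
  have size: "s + 2 * d + 3 * t = k + 5"
    using size_eq_sum_mult[OF le3] sz by (simp add: std)
  have ck: "content_kostka b c m = col_kostka b c s d t" for b c
    unfolding content_kostka_def std using le3 by (rule if_P)
  have fin: "finite (values_of_mult 2 m)" "finite (values_of_mult 3 m)"
    by (simp_all add: finite_values_of_mult)
  consider "d = 0" "t = 0" | "d = 1" "t = 0" | "d = 2" "t = 0" | "d = 0" "t = 1" | "d = 1" "t = 1"
    | "(d, t) \<notin> {(0, 0), (1, 0), (2, 0), (0, 1), (1, 1)}"
    by auto
  then show ?thesis
  proof cases
    case 1
    then have "card (outer_colors m) = s * (s - 1) * (s - 2) * (s - 3)"
      unfolding std using fin by (intro card_outer_colors_type_0_0[OF le3]) auto
    moreover have "s = k + 5" using size 1 by simp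
    ultimately show ?thesis
      unfolding ck using 1
      by (simp add: col_kostka_def field_simps power3_eq_cube power2_eq_square)
  next
    case 2
    then obtain D where "values_of_mult 2 m = {D}" "values_of_mult 3 m = {}"
      unfolding std using fin by (auto simp: card_1_singleton_iff)
    then have "card (outer_colors m) = s * (s - 1) * (s - 2) + 5 * (s * (s - 1))"
      unfolding std by (rule card_outer_colors_type_1_0[OF le3])
    moreover have "s = k + 3" using size 2 by simp
    ultimately show ?thesis
      unfolding ck using 2
      by (simp add: col_kostka_def field_simps power3_eq_cube power2_eq_square)
  next
    case 3
    then obtain D E where "values_of_mult 2 m = {D, E}" "D \<noteq> E" "values_of_mult 3 m = {}"
      unfolding std using fin by (auto simp: card_2_iff)
    then have "card (outer_colors m) = 6 * s + 4"
      unfolding std by (rule card_outer_colors_type_2_0[OF le3])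
    moreover have "s = k + 1" using size 3 by simp
    ultimately show ?thesis
      unfolding ck using 3 by (simp add: col_kostka_def field_simps)
  next
    case 4
    then obtain T where "values_of_mult 2 m = {}" "values_of_mult 3 m = {T}"
      unfolding std using fin by (auto simp: card_1_singleton_iff)
    then have "card (outer_colors m) = 2 * s"
      unfolding std by (rule card_outer_colors_type_0_1[OF le3])
    moreover have "s = k + 2" using size 4 by simp
    ultimately show ?thesis
      unfolding ck using 4 by (simp add: col_kostka_def field_simps)
  next
    case 5
    then obtain D T where "values_of_mult 2 m = {D}" "values_of_mult 3 m = {T}"
      unfolding std by (auto simp: card_1_singleton_iff)
    then have "card (outer_colors m) = 1"
      by (rule card_outer_colors_type_1_1[OF le3])
    then show ?thesis
      unfolding ck using 5 by (simp add: col_kostka_def)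
  next
    case 6
    then have "outer_colors m = {}"
      unfolding std using outer_colors_type_cases(2) by blast
    \<comment> \<open>The case \<open>d = 3\<close>, \<open>t = 0\<close> is a genuine cancellation:
      \<open>col_kostka 2 1\<close> is 2 and \<open>col_kostka 3 0\<close> is 1, the latter weighted
      by -2. This is where the negative coefficient comes from. In the other cases every term
      vanishes.\<close>
    moreover have "?R = 0"
      unfolding ck using 6 by (auto simp: col_kostka_def)
    ultimately show ?thesis by simp
  qed
qed

lemma young_diagram_eq_columns3:
  assumes "c \<le> b" "b \<le> a" "length \<mu> = a"
    and "\<And>i. i < a \<Longrightarrow> \<mu> ! i = 1 + of_bool (i < b) + of_bool (i < c)"
  shows "young_diagram \<mu> = columns3 a b c"
proof (rule set_eqI, simp only: split_paired_all)
  fix i j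
  show "(i, j) \<in> young_diagram \<mu> \<longleftrightarrow> (i, j) \<in> columns3 a b c"
  proof (cases "i < a")
    case True
    then show ?thesis
      using assms(4)[OF True] assms(1,2,3)
      by (cases "i < b"; cases "i < c") (auto simp: young_diagram_def mem_columns3)
  next
    case False
    then show ?thesis using assms(1-3) by (auto simp: young_diagram_def mem_columns3)
  qed
qed

lemma young_diagram_columns3:
  "young_diagram ([3, 2] @ replicate k 1) = columns3 (k + 2) 2 1"
  "young_diagram ([3] @ replicate (k + 2) 1) = columns3 (k + 3) 1 1"
  "k \<ge> 1 \<Longrightarrow> young_diagram (replicate 3 2 @ replicate (k - 1) 1) = columns3 (k + 2) 3 0"
  "young_diagram (replicate 2 2 @ replicate (k + 1) 1) = columns3 (k + 3) 2 0"
  "young_diagram ([2] @ replicate (k + 3) 1) = columns3 (k + 4) 1 0"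
  "young_diagram (replicate (k + 5) 1) = columns3 (k + 5) 0 0"
  by (rule young_diagram_eq_columns3; auto simp: nth_append nth_Cons split: nat.split)+

lemma schur_eq_content_kostka:
  assumes "young_diagram \<mu> = columns3 a b c" "(b, c) \<in> col_shapes" "b \<le> a"
    and "0 \<notin># m" "size m = a + b + c"
  shows "schur \<mu> m = content_kostka b c m"
  using ssyt_columns_count_eq[OF assms(2,5)] assms
  by (simp add: schur_eq_card_ssyt ssyt_columns_count_def)

text \<open>With \<open>chromatic_sym_eq_0\<close> this settles the contents of wrong size and those
  containing 0, where both sides of the expansion vanish.\<close>

lemma schur_eq_0:
  assumes "0 \<in># m \<or> size m \<noteq> card (young_diagram \<mu>)"
  shows "schur \<mu> m = 0"
proof -
  have "\<not> (semistandard_tableau \<mu> T \<and> image_mset T (mset_set (young_diagram \<mu>)) = m)" for T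
  proof
    assume T: "semistandard_tableau \<mu> T \<and> image_mset T (mset_set (young_diagram \<mu>)) = m"
    then have "T z \<in> {1..}" if "z \<in> young_diagram \<mu>" for z
      using that by (auto simp: semistandard_tableau_def)
    then have "0 \<notin># m"
      using T finite_young_diagram[of \<mu>] by force
    moreover have "size m = card (young_diagram \<mu>)"
      using T by (metis size_image_mset size_mset_set)
    ultimately show False using assms by blast
  qed
  then have "{T. semistandard_tableau \<mu> T \<and> image_mset T (mset_set (young_diagram \<mu>)) = m} = {}"
    by blast
  then show ?thesis by (simp only: schur_def card.empty of_nat_0)
qed

lemma chromatic_sym_eq_0:
  assumes "0 \<in># m \<or> size m \<noteq> card (verts G)" "finite (verts G)"
  shows "chromatic_sym G m = 0"
proof -
  have "\<not> (proper_coloring G \<kappa> \<and> image_mset \<kappa> (mset_set (verts G)) = m)" for \<kappa>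
  proof
    assume \<kappa>: "proper_coloring G \<kappa> \<and> image_mset \<kappa> (mset_set (verts G)) = m"
    then have "\<kappa> z \<in> {1..}" if "z \<in> verts G" for z
      using that by (auto simp: proper_coloring_def)
    then have "0 \<notin># m"
      using \<kappa> assms(2) by force
    moreover have "size m = card (verts G)"
      using \<kappa> by (metis size_image_mset size_mset_set)
    ultimately show False using assms(1) by blast
  qed
  then have "{\<kappa>. proper_coloring G \<kappa> \<and> image_mset \<kappa> (mset_set (verts G)) = m} = {}"
    by blast
  then show ?thesis by (simp only: chromatic_sym_def card.empty of_nat_0)
qed

lemma card_verts_blown_up_fork: "finite (verts (blown_up_fork k))" "card (verts (blown_up_fork k)) = k + 5"
proof -
  show "finite (verts (blown_up_fork k))" by (simp add: verts_blown_up_fork)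
  show "card (verts (blown_up_fork k)) = k + 5"
    using arg_cong[OF mset_set_verts_blown_up_fork[of k], of size] by simp
qed

section \<open>Failure of positivity\<close>

text \<open>The new tableau arises by changing the last 1 of the first row to 2.\<close>

lemma ssyt_raise_one:
  assumes \<mu>: "is_partition \<mu>" and m0: "0 \<notin># m" and c1: "count m 1 \<ge> 2" and c2: "count m 2 = 1"
    and T: "T \<in> ssyt (young_diagram \<mu>) m"
  shows "\<exists>T'. T' \<in> ssyt (young_diagram \<mu>) (m - {#1#} + {#2#})"
proof -
  let ?Y = "young_diagram \<mu>"
  have fin: "finite ?Y" by (rule finite_young_diagram)
  have mono: "\<mu> ! i' \<le> \<mu> ! i" if "i \<le> i'" "i' < length \<mu>" for i i'
    using \<mu> that sorted_wrt_nth_less[of "(\<ge>)" \<mu> i i'] by (cases "i = i'") (auto simp: is_partition_def)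
  have down: "(i, j) \<in> ?Y" if "(i', j') \<in> ?Y" "i \<le> i'" "j \<le> j'" for i j i' j'
    using that mono[of i i'] by (auto simp: young_diagram_def)
  have row: "T (i, j) \<le> T (i, j')" if "(i, j) \<in> ?Y" "(i, j') \<in> ?Y" "j < j'" for i j j'
    using T that by (auto simp: ssyt_def)
  have col: "T (i, j) < T (i', j)" if "(i, j) \<in> ?Y" "(i', j) \<in> ?Y" "i < i'" for i i' j
    using T that by (auto simp: ssyt_def)
  have pos: "T z \<ge> 1" if "z \<in> ?Y" for z
    using ssyt_value_mem[OF fin T that] m0 by (cases "T z") auto
  have content: "image_mset T (mset_set ?Y) = m" using T by (simp add: ssyt_def)
  have card_eq: "card {z \<in> ?Y. T z = c} = count m c" for c
  proof -
    have "count m c = (\<Sum>z | z \<in> ?Y \<and> c = T z. 1)"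
      unfolding content[symmetric] count_image_mset' using fin by (intro sum.cong) auto
    also have "\<dots> = card {z \<in> ?Y. T z = c}"
      by (simp add: eq_commute[of c])
    finally show ?thesis ..
  qed
  have row0: "i = 0" if "(i, j) \<in> ?Y" "T (i, j) = 1" for i j
    using col[of 0 j i] down[of i j 0 j] pos[of "(0, j)"] that by (cases "i = 0") auto
  define J where "J = {j. (0, j) \<in> ?Y \<and> T (0, j) = 1}"
  have ones: "{z \<in> ?Y. T z = 1} = Pair 0 ` J"
    using row0 by (auto simp: J_def)
  have cardJ: "card J \<ge> 2"
    using card_eq[of 1, unfolded ones] c1 by (simp add: card_image inj_on_def)
  have finJ: "finite J" using cardJ by (intro card_ge_0_finite) simp
  have neJ: "J \<noteq> {}" using cardJ by auto
  \<comment> \<open>\<open>r\<close> is the column of the last 1; with at least two 1s in the first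
    row it is not column 0.\<close>
  define r where "r = Max J"
  have r: "(0, r) \<in> ?Y" "T (0, r) = 1"
    using Max_in[OF finJ neJ] by (auto simp: r_def J_def)
  have r_max: "j \<le> r" if "(0, j) \<in> ?Y" "T (0, j) = 1" for j
    using that finJ by (auto simp: r_def J_def)
  have r_pos: "r > 0"
  proof (rule ccontr)
    assume "\<not> r > 0"
    then have "J \<subseteq> {0}" using r_max by (auto simp: J_def)
    then have "card J \<le> 1" using card_mono[of "{0}" J] by simp
    with cardJ show False by simp
  qed
  \<comment> \<open>A 2 below the changed cell would force another 2 at the start of its row, since
    that entry is at most 2 and lies below a positive one. But 2 occurs only once in
    \<open>m\<close>.\<close>
  have below: "T (i, r) > 2" if "(i, r) \<in> ?Y" "i > 0" for i
  proof (rule ccontr)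
    assume "\<not> T (i, r) > 2"
    with col[OF r(1) that] r have two: "T (i, r) = 2" by simp
    have i0: "(i, 0) \<in> ?Y" "(0, 0) \<in> ?Y" using down[OF that(1)] by auto
    have "T (i, 0) = 2"
      using row[OF i0(1) that(1) r_pos] col[OF i0(2) i0(1) that(2)] pos[OF i0(2)] two by simp
    then have "{(i, 0), (i, r)} \<subseteq> {z \<in> ?Y. T z = 2}" using two i0 that by auto
    then have "card {(i, 0), (i, r)} \<le> card {z \<in> ?Y. T z = 2}"
      using fin by (intro card_mono) auto
    then show False using card_eq[of 2] c2 r_pos by simp
  qed
  have right: "T (0, j) \<ge> 2" if "(0, j) \<in> ?Y" "j > r" for j
    using r_max[of j] pos[OF that(1)] that by fastforce
  define T' where "T' = T((0, r) := 2)"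
  have "T' (i, j) \<le> T' (i, j')" if "(i, j) \<in> ?Y" "(i, j') \<in> ?Y" "j < j'" for i j j'
    using row[OF that] right[of j'] that r by (auto simp: T'_def)
  moreover have "T' (i, j) < T' (i', j)" if "(i, j) \<in> ?Y" "(i', j) \<in> ?Y" "i < i'" for i i' j
    using col[OF that] below[of i'] that by (auto simp: T'_def)
  moreover have "T' \<in> extensional ?Y"
    using T r(1) by (auto simp: T'_def ssyt_def extensional_def)
  moreover have "image_mset T' (mset_set ?Y) = m - {#1#} + {#2#}"
  proof -
    have "image_mset T' (mset_set (?Y - {(0, r)})) = image_mset T (mset_set (?Y - {(0, r)}))"
      using fin by (intro image_mset_cong) (auto simp: T'_def)
    then show ?thesis
      using image_mset_split[OF fin, of "{(0, r)}" T] image_mset_split[OF fin, of "{(0, r)}" T'] r content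
      by (simp add: T'_def)
  qed
  ultimately show ?thesis unfolding ssyt_def by blast
qed

lemma not_schur_positive_blown_up_fork:
  assumes "k \<ge> 1"
  shows "\<not> schur_positive (chromatic_sym (blown_up_fork k))"
proof
  let ?X = "chromatic_sym (blown_up_fork k)"
  assume "schur_positive ?X"
  then obtain c where c: "schur_expansion c ?X" and pos: "\<And>\<mu>. c \<mu> \<ge> 0"
    unfolding schur_positive_def by blast
  have fin: "finite {\<mu>. c \<mu> \<noteq> 0}" and part: "\<And>\<mu>. c \<mu> \<noteq> 0 \<Longrightarrow> is_partition \<mu>"
    using c by (simp_all add: schur_expansion_def)
  have X: "?X m = (\<Sum>\<mu> | c \<mu> \<noteq> 0. c \<mu> * schur \<mu> m)" for m
    using c unfolding schur_expansion_def by (metis (no_types, lifting))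
  \<comment> \<open>Raising a 1 to a 2 turns multiplicities 3, 1, 2 of the values 1, 2, 3 into 2, 2,
    2. The \<open>k - 1\<close> values from 4 to \<open>k + 2\<close> fill up the size
    \<open>k + 5\<close>.\<close>
  define m where "m = {#1, 1, 1, 2, 3, 3#} + mset_set {4..k + 2}"
  define m' where "m' = m - {#1#} + {#2#}"
  have m'_eq: "m' = {#1, 1, 2, 2, 3, 3#} + mset_set {4..k + 2}"
    by (simp add: m'_def m_def)
  have count_m: "count m z = (if z = 1 then 3 else if z = 2 then 1 else if z = 3 then 2
      else if 4 \<le> z \<and> z \<le> k + 2 then 1 else 0)" for z
    by (auto simp: m_def count_mset_set')
  have count_m': "count m' z = (if z = 1 then 2 else if z = 2 then 2 else if z = 3 then 2
      else if 4 \<le> z \<and> z \<le> k + 2 then 1 else 0)" for z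
    by (auto simp: m'_eq count_mset_set')
  have m0: "0 \<notin># m" "0 \<notin># m'"
    by (simp_all add: not_in_iff count_m count_m')
  have size: "size m = k + 5" "size m' = k + 5"
    using assms by (simp_all add: m_def m'_eq)
  \<comment> \<open>Color 1 on v, x, y, and color 3 on u and one clique vertex.\<close>
  have "(3, 1, 1, 1) \<in> outer_colors m"
    by (auto simp: mem_outer_colors_iff count_m)
  moreover have "finite (outer_colors m)"
    by (rule finite_outer_colors)
  ultimately have "card (outer_colors m) \<noteq> 0" by auto
  then have Xm: "?X m \<noteq> 0"
    by (simp add: chromatic_sym_blown_up_fork[OF m0(1) size(1)] del: fact_Suc)
  \<comment> \<open>Three doubled colors, a type for which no proper coloring exists.\<close>
  have "values_of_mult 2 m' = {1, 2, 3}"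
    by (auto simp: values_of_mult_def count_m')
  then have "outer_colors m' = {}"
    using outer_colors_type_cases(2)[of m'] by auto
  then have Xm': "?X m' = 0"
    by (simp add: chromatic_sym_blown_up_fork[OF m0(2) size(2)])
  obtain \<mu> where \<mu>: "c \<mu> \<noteq> 0" "schur \<mu> m \<noteq> 0"
    using Xm sum.neutral[of "{\<mu>. c \<mu> \<noteq> 0}" "\<lambda>\<mu>. c \<mu> * schur \<mu> m"] unfolding X by fastforce
  have nonneg: "schur \<nu> m' \<ge> 0" for \<nu> by (simp add: schur_def)
  \<comment> \<open>A sum of non-negative terms vanishes only termwise, so the shape found for
    \<open>m\<close> can have no tableau of content \<open>m'\<close>.\<close>
  have "c \<mu> * schur \<mu> m' = 0"
    using Xm' \<mu>(1) fin pos nonneg unfolding X by (subst (asm) sum_nonneg_eq_0_iff) auto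
  then have "ssyt (young_diagram \<mu>) m' = {}"
    using \<mu>(1) finite_ssyt[OF finite_young_diagram] by (simp add: schur_eq_card_ssyt[OF m0(2)])
  moreover obtain T where "T \<in> ssyt (young_diagram \<mu>) m"
    using \<mu>(2) by (auto simp: schur_eq_card_ssyt[OF m0(1)] card_eq_0_iff)
  then have "\<exists>T'. T' \<in> ssyt (young_diagram \<mu>) m'"
    unfolding m'_def by (intro ssyt_raise_one[OF part[OF \<mu>(1)] m0(1)]) (simp_all add: count_m)
  ultimately show False by blast
qed

theorem theorem4p1:
  fixes k :: nat
  assumes "k \<ge> 1"
  shows "(chromatic_sym (replace_by_clique fork_graph fork_w k) = (\<lambda>m.
             fact (k + 1) * schur ([3, 2] @ replicate k 1) m
           + (of_nat k + 3) * fact (k + 1) * schur ([3] @ replicate (k + 2) 1) m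
           - 2 * fact (k + 1) * schur (replicate 3 2 @ replicate (k - 1) 1) m
           + 5 * (of_nat k + 1) * fact (k + 1) * schur (replicate 2 2 @ replicate (k + 1) 1) m
           + (of_nat k ^ 3 + 5 * of_nat k ^ 2 + 14 * of_nat k + 14) * fact (k + 1)
               * schur ([2] @ replicate (k + 3) 1) m
           + 2 * (of_nat k + 2) ^ 3 * fact (k + 1) * schur (replicate (k + 5) 1) m))
    \<and> \<not> schur_positive (chromatic_sym (replace_by_clique fork_graph fork_w k))"
proof (rule conjI[OF ext not_schur_positive_blown_up_fork[OF assms]])
  fix m
  note shapes = young_diagram_columns3(1,2)[of k] young_diagram_columns3(3)[OF assms]
    young_diagram_columns3(4-6)[of k]
  show "chromatic_sym (blown_up_fork k) m =
             fact (k + 1) * schur ([3, 2] @ replicate k 1) m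
           + (of_nat k + 3) * fact (k + 1) * schur ([3] @ replicate (k + 2) 1) m
           - 2 * fact (k + 1) * schur (replicate 3 2 @ replicate (k - 1) 1) m
           + 5 * (of_nat k + 1) * fact (k + 1) * schur (replicate 2 2 @ replicate (k + 1) 1) m
           + (of_nat k ^ 3 + 5 * of_nat k ^ 2 + 14 * of_nat k + 14) * fact (k + 1)
               * schur ([2] @ replicate (k + 3) 1) m
           + 2 * (of_nat k + 2) ^ 3 * fact (k + 1) * schur (replicate (k + 5) 1) m"
  \<comment> \<open>The power series must agree at every multiset, including those that are not the
    content of any coloring or tableau here.\<close>
  proof (cases "0 \<notin># m \<and> size m = k + 5")
    case True
    then have m: "0 \<notin># m" "size m = k + 5" by auto
    have schur:
      "schur ([3, 2] @ replicate k 1) m = content_kostka 2 1 m"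
      "schur ([3] @ replicate (k + 2) 1) m = content_kostka 1 1 m"
      "schur (replicate 3 2 @ replicate (k - 1) 1) m = content_kostka 3 0 m"
      "schur (replicate 2 2 @ replicate (k + 1) 1) m = content_kostka 2 0 m"
      "schur ([2] @ replicate (k + 3) 1) m = content_kostka 1 0 m"
      "schur (replicate (k + 5) 1) m = content_kostka 0 0 m"
      by (rule shapes[THEN schur_eq_content_kostka]; use m assms in \<open>simp add: col_shapes_def\<close>)+
    show ?thesis
      unfolding chromatic_sym_blown_up_fork[OF m] card_outer_colors_eq[OF m(2)] schur
      by (simp only: algebra_simps)
  next
    case False
    then have "schur \<mu> m = 0" if "card (young_diagram \<mu>) = k + 5" for \<mu>
      using that by (intro schur_eq_0) auto
    then have "schur ([3, 2] @ replicate k 1) m = 0" "schur ([3] @ replicate (k + 2) 1) m = 0"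
      "schur (replicate 3 2 @ replicate (k - 1) 1) m = 0"
      "schur (replicate 2 2 @ replicate (k + 1) 1) m = 0"
      "schur ([2] @ replicate (k + 3) 1) m = 0" "schur (replicate (k + 5) 1) m = 0"
      by (simp_all only: shapes card_columns3)
    moreover have "chromatic_sym (blown_up_fork k) m = 0"
      using False card_verts_blown_up_fork by (intro chromatic_sym_eq_0) auto
    ultimately show ?thesis by (simp only: mult_zero_right add_0_right diff_0_right)
  qed
qed

end
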